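(* Let $F(z)=\sum_{r=1}^R\delta_r e^{z\overline{\gamma_r}}$ be in the generic case described in the context. If $N(E)$ is the number of zeros of $F(z)$ such that $|z|\le E$ then $$N(E)=\frac{b(K)E}{2\pi}+O(1)$$ as $E\to\infty$, where $b(K)$ is the length of the boundary of $K$.
   Context: $R\ge2$, the $\gamma_r\in\mathbb{C}$ are all different and all $\delta_r\in\mathbb{C}$ are non-zero. $K$ is the convex hull of $\{\gamma_1,\dots,\gamma_R\}$. Generic case: the $\gamma_r$ which are not vertices of $K$ lie in the interior of $K$, i.e. no $\gamma_r$ lies on an edge of $K$ unless it is a vertex of $K$. If $K$ is a segment, it is regarded as having two edges and $b(K)$ is twice the length of the segment. *)

theory Defs
  imports "HOL-Complex_Analysis.Complex_Analysis" "HOL-Library.Landau_Symbols"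
begin

definition exp_sum :: "nat \<Rightarrow> (nat \<Rightarrow> complex) \<Rightarrow> (nat \<Rightarrow> complex) \<Rightarrow> complex \<Rightarrow> complex" where
  "exp_sum R \<delta> \<gamma> z = (\<Sum>r=1..R. \<delta> r * exp (z * cnj (\<gamma> r)))"

definition exponent_hull :: "nat \<Rightarrow> (nat \<Rightarrow> complex) \<Rightarrow> complex set" where
  "exponent_hull R \<gamma> = convex hull (\<gamma> ` {1..R})"

(* The interior is the topological one. A segment has empty interior, so in the collinear
   case every \<gamma> r must be an endpoint. *)
definition generic_exponents :: "nat \<Rightarrow> (nat \<Rightarrow> complex) \<Rightarrow> bool" where
  "generic_exponents R \<gamma> \<longleftrightarrow>
     (\<forall>r\<in>{1..R}. \<gamma> r extreme_point_of exponent_hull R \<gamma> \<or> \<gamma> r \<in> interior (exponent_hull R \<gamma>))"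

(* For a convex polygon: an edge is a closed segment, so its length is its diameter.
   A non-degenerate segment is its own only face of dimension 1, but it counts as two edges,
   hence the case distinction. *)
definition boundary_length :: "complex set \<Rightarrow> real" where
  "boundary_length K =
     (if aff_dim K = 1 then 2 * diameter K else (\<Sum>e | e edge_of K. diameter e))"

definition zeros_upto :: "(complex \<Rightarrow> complex) \<Rightarrow> real \<Rightarrow> complex set" where
  "zeros_upto f E = {z. f z = 0 \<and> norm z \<le> E}"

definition zero_count :: "(complex \<Rightarrow> complex) \<Rightarrow> real \<Rightarrow> real" where
  "zero_count f E = real (card (zeros_upto f E))"

(* Zeros counted with multiplicity. *)
definition zero_count_mult :: "(complex \<Rightarrow> complex) \<Rightarrow> real \<Rightarrow> real" where
  "zero_count_mult f E = (\<Sum>z\<in>zeros_upto f E. real_of_int (zorder f z))"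

end

theory Submission
  imports Defs
begin

text \<open>The modulus of a single term $\delta_r e^{z\overline{\gamma_r}}$ is $|\delta_r|$ times the exponential of the
inner product of \<open>z\<close> and \<open>\<gamma> r\<close>.  So far from the origin the sum is dominated by the \<open>\<gamma> r\<close> extremal in the
direction of \<open>z\<close>, and it can vanish only where at least two frequencies are almost equally extremal,
that is, within a bounded distance of the ray along the outer normal of an edge of \<open>K\<close>.  In the
generic case only the two endpoints \<open>p\<close>, \<open>q\<close> of the edge compete there, and all other terms are exponentially smaller.

Near such a ray the variable \<open>w = z * cnj (p - q)\<close> runs through a vertical half strip, and after division
by a term without zeros the sum becomes \<open>exp w + \<beta> + h w\<close>, where \<open>h\<close> and its derivative decay as \<open>Im w\<close>
grows.  Its zeros high up in the strip are the solutions of \<open>w = 2 * pi * k * \<i> + Ln (- \<beta>) + Ln (1 + h w / \<beta>)\<close> for integers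
\<open>k\<close>.  For each large \<open>k\<close> the right-hand side is a contraction of a unit disc, so there is exactly one
solution, and it is a simple zero at a bounded distance from \<open>2 * pi * k * \<i>\<close>.  This is
\<open>perturbed_exponential_zeros\<close>; it takes the place of Rouche's theorem.

Hence every edge contributes one sequence of simple zeros with $|z| = 2\pi k/|p - q| + O(1)$
(\<open>edge_zero_sequence\<close>).  The half strips of different edges are disjoint far out
(\<open>edge_strips_disjoint\<close>) and contain all zeros of large modulus (\<open>large_zero_in_edge_strip\<close>), so the
number of zeros up to \<open>E\<close> is the sum of $|p - q| E/(2\pi) + O(1)$ over the edges.  Multiplicities
only matter for the finitely many zeros in a fixed disc, which is why both counts obey the same law.

Edges enter as ordered pairs of endpoints, oriented counterclockwise.  If \<open>K\<close> is a segment, both orders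
of its endpoints qualify, one for each of the two normal directions; this produces the
convention that the segment counts twice (\<open>boundary_length_eq_sum_oriented_edges\<close>).\<close>

section \<open>Oriented edges of a planar convex hull\<close>

text \<open>The vector \<open>\<i> * (p - q)\<close> is the outer normal of the edge: the hull lies to the left when one walks
from \<open>p\<close> to \<open>q\<close>.  Using pairs of points instead of faces makes no case distinction necessary for a
segment, which has one pair for each of its two sides.\<close>
definition oriented_edges :: "complex set \<Rightarrow> (complex \<times> complex) set" where
  "oriented_edges S = {(p, q). p \<in> S \<and> q \<in> S \<and> p \<noteq> q \<and>
     (\<forall>c\<in>S. (\<i> * (p - q)) \<bullet> (c - q) \<le> 0)}"

text \<open>This is the form in which genericity enters the analysis: on the supporting line of an edge
there are only the two endpoints, so exactly two terms compete along its normal.\<close>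
definition edges_without_inner_points :: "complex set \<Rightarrow> bool" where
  "edges_without_inner_points S \<longleftrightarrow>
     (\<forall>(p, q)\<in>oriented_edges S. \<forall>c\<in>S - {p, q}. (\<i> * (p - q)) \<bullet> (c - q) < 0)"

lemma edges_without_inner_pointsD:
  assumes "edges_without_inner_points S" "(p, q) \<in> oriented_edges S" "c \<in> S" "c \<notin> {p, q}"
  shows "(\<i> * (p - q)) \<bullet> (c - q) < 0"
  using assms unfolding edges_without_inner_points_def by fast

lemma oriented_edges_finite: "finite S \<Longrightarrow> finite (oriented_edges S)"
  by (rule finite_subset[of _ "S \<times> S"]) (auto simp: oriented_edges_def)

lemma inner_rotate_eq_0_imp_on_line:
  fixes d v :: complex
  assumes "(\<i> * d) \<bullet> v = 0" "d \<noteq> 0"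
  shows "v = Re (v / d) *\<^sub>R d"
proof -
  have "Im (v / d) = 0"
    using assms by (simp add: Im_divide inner_complex_def algebra_simps)
  then have "v / d = of_real (Re (v / d))" by (simp add: complex_eq_iff)
  then show ?thesis using assms(2) by (simp add: scaleR_conv_of_real field_simps)
qed

text \<open>A point of \<open>S\<close> on the supporting line of an edge is not interior to the hull, so it would be
extreme, as \<open>p\<close> and \<open>q\<close> are; but of three collinear points one lies between the other two.\<close>
lemma generic_imp_edges_without_inner_points:
  assumes generic: "\<And>c. c \<in> S \<Longrightarrow> c extreme_point_of convex hull S \<or> c \<in> interior (convex hull S)"
  shows "edges_without_inner_points S"
proof -
  have "(\<i> * (p - q)) \<bullet> (c - q) < 0"
    if pq: "(p, q) \<in> oriented_edges S" and c: "c \<in> S" "c \<notin> {p, q}" for p q c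
  proof (rule ccontr)
    assume "\<not> (\<i> * (p - q)) \<bullet> (c - q) < 0"
    define n where "n = \<i> * (p - q)"
    have S: "p \<in> S" "q \<in> S" "p \<noteq> q" and le: "\<And>c. c \<in> S \<Longrightarrow> n \<bullet> (c - q) \<le> 0"
      using pq by (auto simp: oriented_edges_def n_def)
    have n0: "n \<noteq> 0" using S by (simp add: n_def)
    have c0: "n \<bullet> (c - q) = 0"
      using le[OF c(1)] \<open>\<not> (\<i> * (p - q)) \<bullet> (c - q) < 0\<close> by (simp add: n_def)
    have "convex hull S \<subseteq> {x. n \<bullet> x \<le> n \<bullet> q}"
      by (rule hull_minimal) (use le in \<open>auto simp: inner_diff_right convex_halfspace_le\<close>)
    then have int: "interior (convex hull S) \<subseteq> {x. n \<bullet> x < n \<bullet> q}"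
      using interior_mono interior_halfspace_le[OF n0] by metis
    have ext: "x extreme_point_of convex hull S" if "x \<in> {p, q, c}" for x
    proof -
      have "n \<bullet> (x - q) = 0" using that c0 by (auto simp: n_def inner_complex_def algebra_simps)
      then have "x \<notin> interior (convex hull S)" using int by (auto simp: inner_diff_right)
      then show ?thesis using generic that S c by blast
    qed
    have "c - q = Re ((c - q) / (p - q)) *\<^sub>R (p - q)"
      using inner_rotate_eq_0_imp_on_line c0 S unfolding n_def by simp
    then have "c = Re ((c - q) / (p - q)) *\<^sub>R p + (1 - Re ((c - q) / (p - q))) *\<^sub>R q"
      by (simp add: algebra_simps)
    then have "collinear {p, c, q}"
      using collinear_3_expand by blast
    then have "collinear {c, p, q}"
      by (simp add: insert_commute)
    then have "between (p, q) c \<or> between (q, c) p \<or> between (c, p) q"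
      by (simp add: collinear_between_cases)
    moreover have "x \<notin> open_segment y z" if "x \<in> {p, q, c}" "y \<in> {p, q, c}" "z \<in> {p, q, c}" for x y z
      using ext[OF that(1)] ext[OF that(2)] ext[OF that(3)] by (auto simp: extreme_point_of_def)
    ultimately show False
      using S c by (auto simp: between_mem_segment closed_segment_eq_open)
  qed
  then show ?thesis by (auto simp: edges_without_inner_points_def)
qed

lemma diameter_closed_segment: "diameter (closed_segment a b) = dist a b"
  for a b :: "'a::euclidean_space"
proof (rule antisym)
  show "diameter (closed_segment a b) \<le> dist a b"
  proof (rule diameter_le)
    fix x y assume x: "x \<in> closed_segment a b" and y: "y \<in> closed_segment a b"
    have "norm (x - y) \<le> norm (x - a) \<or> norm (x - y) \<le> norm (x - b)"
      using segment_furthest_le[OF y, of x] by (simp add: norm_minus_commute)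
    then show "norm (x - y) \<le> dist a b"
      using segment_bound[OF x] by (auto simp: dist_norm norm_minus_commute)
  qed simp
  show "dist a b \<le> diameter (closed_segment a b)"
    by (rule diameter_bounded_bound) (auto simp: bounded_closed_segment)
qed

text \<open>The supporting line of the edge misses the convex hull of the remaining points, which lie strictly
on one side.\<close>
lemma oriented_edge_is_edge:
  assumes "finite S" "edges_without_inner_points S" "(p, q) \<in> oriented_edges S"
  shows "closed_segment p q edge_of convex hull S"
proof -
  define n where "n = \<i> * (p - q)"
  have S: "p \<in> S" "q \<in> S" "p \<noteq> q" and lt: "\<And>c. c \<in> S - {p, q} \<Longrightarrow> n \<bullet> (c - q) < 0"
    using assms by (auto simp: oriented_edges_def edges_without_inner_points_def n_def)
  have "affine hull {p, q} \<subseteq> {x. n \<bullet> x = n \<bullet> q}"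
  proof (rule hull_minimal)
    have "n \<bullet> p = n \<bullet> q" by (simp add: n_def inner_complex_def algebra_simps)
    then show "{p, q} \<subseteq> {x. n \<bullet> x = n \<bullet> q}" by simp
  qed (rule affine_hyperplane)
  moreover have "convex hull (S - {p, q}) \<subseteq> {x. n \<bullet> x < n \<bullet> q}"
    by (rule hull_minimal) (use lt in \<open>auto simp: inner_diff_right convex_halfspace_lt\<close>)
  ultimately have "affine hull {p, q} \<inter> convex hull (S - {p, q}) = {}" by force
  then have "convex hull {p, q} face_of convex hull S"
    using S by (intro face_of_convex_hulls assms) auto
  then show ?thesis
    using S unfolding edge_of_def segment_convex_hull aff_dim_convex_hull by simp
qed

text \<open>An edge of a polytope is exposed, and it is spanned by points of \<open>S\<close>.  Any two of these determine
the direction of the edge, hence the exposing functional up to a factor, and the sign of that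
factor decides the orientation.\<close>
lemma edge_is_oriented_edge:
  assumes "finite S" "edges_without_inner_points S" "aff_dim S \<noteq> 1" "e edge_of convex hull S"
  obtains p q where "(p, q) \<in> oriented_edges S" "e = closed_segment p q"
proof -
  have e: "e face_of convex hull S" "aff_dim e = 1"
    using assms(4) by (auto simp: edge_of_def)
  obtain T where T: "T \<subseteq> S" "e = convex hull T"
    using face_of_convex_hull_subset[OF _ e(1)] assms(1) finite_imp_compact by blast
  have "aff_dim T = 1" using e T by (metis aff_dim_convex_hull)
  have "\<not> T \<subseteq> {a}" for a
    using aff_dim_subset[of T "{a}"] \<open>aff_dim T = 1\<close> by auto
  then obtain p q where pq: "p \<in> T" "q \<in> T" "p \<noteq> q" by (metis insertI1 singletonD subsetI)
  have "e exposed_face_of convex hull S"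
    using e(1) exposed_face_of_polyhedron polytope_convex_hull[OF assms(1)] polytope_imp_polyhedron by blast
  moreover have "e \<noteq> convex hull S" "e \<noteq> {}"
    using e assms(3) by (auto simp: aff_dim_convex_hull)
  ultimately obtain a b where ab: "a \<noteq> 0" "convex hull S \<subseteq> {x. a \<bullet> x \<le> b}"
      "e = convex hull S \<inter> {x. a \<bullet> x = b}"
    unfolding exposed_face_of by blast
  have T_eq: "a \<bullet> c = b" if "c \<in> T" for c
    using that T ab(3) hull_inc[of c T] by blast
  have S_le: "a \<bullet> c \<le> b" if "c \<in> S" for c
    using that ab(2) hull_inc[of c S] by blast
  have "a \<bullet> (p - q) = 0" using T_eq pq by (simp add: inner_diff_right)
  then have "(\<i> * (p - q)) \<bullet> (\<i> * a) = 0"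
    by (simp add: inner_complex_def algebra_simps)
  then obtain s where "\<i> * a = s *\<^sub>R (p - q)"
    using inner_rotate_eq_0_imp_on_line pq by (metis right_minus_eq)
  then have "\<i> * (\<i> * a) = s *\<^sub>R (\<i> * (p - q))" by (metis mult_scaleR_right)
  then have "- a = s *\<^sub>R (\<i> * (p - q))" by simp
  then have a: "a = (- s) *\<^sub>R (\<i> * (p - q))" by (metis minus_minus scaleR_minus_left)
  have le: "- s * ((\<i> * (p - q)) \<bullet> (c - q)) \<le> 0" if "c \<in> S" for c
    using S_le[OF that] T_eq[OF pq(2)] unfolding inner_scaleR_left[symmetric] a[symmetric]
    by (simp add: inner_diff_right)
  obtain p' q' where pq': "(p', q') \<in> oriented_edges S" "{p', q'} = {p, q}"
  proof (cases "s < 0")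
    case True
    then have "(p, q) \<in> oriented_edges S"
      using le pq T(1) by (auto simp: oriented_edges_def zero_le_mult_iff mult_le_0_iff)
    then show thesis using that by blast
  next
    case False
    then have "s > 0" using a ab(1) by (cases "s = 0") auto
    moreover have "(\<i> * (q - p)) \<bullet> (c - p) = - ((\<i> * (p - q)) \<bullet> (c - q))" for c
      by (simp add: inner_complex_def algebra_simps)
    ultimately have "(q, p) \<in> oriented_edges S"
      using le pq T(1) by (auto simp: oriented_edges_def zero_le_mult_iff mult_le_0_iff)
    then show thesis using that by blast
  qed
  have "c \<in> {p', q'}" if "c \<in> T" for c
  proof (rule ccontr)
    assume "c \<notin> {p', q'}"
    then have "(\<i> * (p' - q')) \<bullet> (c - q') < 0"
      using edges_without_inner_pointsD[OF assms(2) pq'(1)] that T(1) by blast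
    then have "(\<i> * (p - q)) \<bullet> (c - q) \<noteq> 0"
      using pq'(2) by (auto simp: doubleton_eq_iff inner_complex_def algebra_simps)
    moreover have "a \<bullet> (c - q) = 0" using T_eq[OF that] T_eq[OF pq(2)] by (simp add: inner_diff_right)
    ultimately have "s = 0" by (subst (asm) a) simp
    then show False using a ab(1) by simp
  qed
  then have "T = {p', q'}" using pq pq'(2) by blast
  then show thesis using that pq'(1) T(2) by (simp add: segment_convex_hull)
qed

text \<open>If the hull is a segment, then \<open>S\<close> consists of its two endpoints, and both orders are oriented edges.
Otherwise an edge cannot be oriented in both ways, since then all of \<open>S\<close> would lie on its line; so
oriented edges correspond bijectively to edges.\<close>
lemma boundary_length_eq_sum_oriented_edges:
  assumes "finite S" "edges_without_inner_points S" "p0 \<in> S" "q0 \<in> S" "p0 \<noteq> q0"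
  shows "boundary_length (convex hull S) = (\<Sum>(p, q)\<in>oriented_edges S. dist p q)"
proof (cases "aff_dim S = 1")
  case True
  then have "collinear S" by (simp add: collinear_aff_dim)
  then obtain u where u: "\<And>x y. x \<in> S \<Longrightarrow> y \<in> S \<Longrightarrow> \<exists>c. x - y = c *\<^sub>R u"
    unfolding collinear_def by blast
  have flat: "(\<i> * (p - q)) \<bullet> (c - q) = 0" if *: "p \<in> S" "q \<in> S" "c \<in> S" for p q c
  proof -
    obtain s t where "p - q = s *\<^sub>R u" "c - q = t *\<^sub>R u"
      using u[OF *(1,2)] u[OF *(3,2)] by blast
    then show ?thesis by (simp add: inner_complex_def algebra_simps)
  qed
  have edges: "(p, q) \<in> oriented_edges S" if "p \<in> S" "q \<in> S" "p \<noteq> q" for p q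
    using that flat by (auto simp: oriented_edges_def)
  have "S - {p0, q0} = {}"
    using edges_without_inner_pointsD[OF assms(2) edges[OF assms(3-5)]] flat[OF assms(3,4)]
    by (metis DiffE all_not_in_conv less_irrefl)
  then have S: "S = {p0, q0}" using assms by blast
  have "oriented_edges S = {(p0, q0), (q0, p0)}"
    using edges assms(3-5) by (auto simp: S oriented_edges_def)
  moreover have "(p0, q0) \<noteq> (q0, p0)" using assms(5) by simp
  ultimately have "(\<Sum>(p, q)\<in>oriented_edges S. dist p q) = dist p0 q0 + dist q0 p0" by simp
  then show ?thesis
    using True diameter_closed_segment[of p0 q0]
    by (simp add: boundary_length_def S segment_convex_hull dist_commute aff_dim_convex_hull)
next
  case False
  have inj: "inj_on (\<lambda>(p, q). closed_segment p q) (oriented_edges S)"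
  proof (rule inj_onI, clarsimp)
    fix p q p' q'
    assume pq: "(p, q) \<in> oriented_edges S" and pq': "(p', q') \<in> oriented_edges S"
      and "{p, q} = {p', q'}"
    moreover have False if "(q, p) \<in> oriented_edges S"
    proof -
      have "c \<in> {p, q}" if c: "c \<in> S" for c
      proof (rule ccontr)
        assume "c \<notin> {p, q}"
        then have "(\<i> * (p - q)) \<bullet> (c - q) < 0" "(\<i> * (q - p)) \<bullet> (c - p) < 0"
          using edges_without_inner_pointsD[OF assms(2)] pq \<open>(q, p) \<in> oriented_edges S\<close> c
          by (auto simp: insert_commute)
        then show False by (simp add: inner_complex_def algebra_simps)
      qed
      then have "S = {p, q}" "p \<noteq> q" using pq by (auto simp: oriented_edges_def)
      then show False using False by simp
    qed
    ultimately show "p = p' \<and> q = q'" by (auto simp: doubleton_eq_iff)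
  qed
  have img: "{e. e edge_of convex hull S} = (\<lambda>(p, q). closed_segment p q) ` oriented_edges S"
  proof (intro equalityI subsetI)
    fix e assume "e \<in> {e. e edge_of convex hull S}"
    then show "e \<in> (\<lambda>(p, q). closed_segment p q) ` oriented_edges S"
      using edge_is_oriented_edge[OF assms(1,2) False] by (auto intro: rev_image_eqI)
  qed (use oriented_edge_is_edge[OF assms(1,2)] in auto)
  have "boundary_length (convex hull S) = (\<Sum>e | e edge_of convex hull S. diameter e)"
    using False by (simp add: boundary_length_def aff_dim_convex_hull)
  also have "\<dots> = (\<Sum>(p, q)\<in>oriented_edges S. dist p q)"
    unfolding img sum.reindex[OF inj]
    by (rule sum.cong) (auto simp: diameter_closed_segment)
  finally show ?thesis .
qed

section \<open>Zeros of a perturbed exponential in a half strip\<close>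

text \<open>Where \<open>h\<close> is small, \<open>exp w + \<beta> + h w = 0\<close> means that \<open>w\<close> is a fixed point of
\<open>\<lambda>w. 2 * pi * k * \<i> + Ln (- \<beta>) + g w\<close> with \<open>g w = Ln (1 + h w / \<beta>)\<close> for some integer \<open>k\<close>.  Smallness of
\<open>h\<close> and \<open>h'\<close> makes \<open>g\<close> bounded by a half and Lipschitz with constant a half, so Banach's theorem
gives exactly one zero for each large \<open>k\<close>.  The lower bound on \<open>C\<close> keeps the unit discs in which this
happens inside the strip.\<close>
lemma perturbed_exponential_zeros:
  fixes h h' :: "complex \<Rightarrow> complex" and \<beta> :: complex and C :: real
  assumes \<beta>: "\<beta> \<noteq> 0"
    and der: "\<And>w. (h has_field_derivative h' w) (at w)"
    and small: "\<And>\<eta>. \<eta> > 0 \<Longrightarrow> \<exists>Y. \<forall>w. \<bar>Re w\<bar> \<le> C \<longrightarrow> Im w \<ge> Y \<longrightarrow> norm (h w) \<le> \<eta> \<and> norm (h' w) \<le> \<eta>"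
    and C: "norm (Ln (-\<beta>)) + 1 \<le> C"
  obtains \<omega> :: "nat \<Rightarrow> complex" and N Y where
    "\<And>k. k \<ge> N \<Longrightarrow> exp (\<omega> k) + \<beta> + h (\<omega> k) = 0"
    "\<And>k. k \<ge> N \<Longrightarrow> norm (\<omega> k - 2 * pi * real k * \<i>) \<le> C"
    "inj_on \<omega> {N..}"
    "\<And>w. \<bar>Re w\<bar> \<le> C \<Longrightarrow> Im w \<ge> Y \<Longrightarrow> exp w + \<beta> + h w = 0 \<Longrightarrow> w \<in> \<omega> ` {N..} \<and> exp w + h' w \<noteq> 0"
proof -
  define \<alpha> where "\<alpha> = Ln (-\<beta>)"
  have exp\<alpha>: "exp \<alpha> = -\<beta>" using \<beta> by (simp add: \<alpha>_def)
  define g where "g = (\<lambda>w. Ln (1 + h w / \<beta>))"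
  obtain Y where Y: "\<And>w. \<bar>Re w\<bar> \<le> C \<Longrightarrow> Im w \<ge> Y \<Longrightarrow> norm (h w) \<le> norm \<beta> / 4 \<and> norm (h' w) \<le> norm \<beta> / 4"
    using small[of "norm \<beta> / 4"] \<beta> by auto
  have quot: "norm (h w / \<beta>) \<le> 1/4" "norm (h' w / \<beta>) \<le> 1/4" if "\<bar>Re w\<bar> \<le> C" "Im w \<ge> Y" for w
    using Y[OF that] \<beta> by (simp_all add: norm_divide divide_simps)
  have nz: "1 + h w / \<beta> \<notin> \<real>\<^sub>\<le>\<^sub>0" "norm (1 + h w / \<beta>) \<ge> 1/2" if "\<bar>Re w\<bar> \<le> C" "Im w \<ge> Y" for w
  proof -
    have "\<bar>Re (h w / \<beta>)\<bar> \<le> 1/4"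
      using quot(1)[OF that] abs_Re_le_cmod[of "h w / \<beta>"] by linarith
    then have "Re (1 + h w / \<beta>) > 0" by simp
    then show "1 + h w / \<beta> \<notin> \<real>\<^sub>\<le>\<^sub>0" by (auto simp: complex_nonpos_Reals_iff)
    show "norm (1 + h w / \<beta>) \<ge> 1/2"
      using quot(1)[OF that] norm_triangle_ineq4[of "1 + h w / \<beta>" "h w / \<beta>"] by simp
  qed
  have g_small: "norm (g w) \<le> 1/2" if "\<bar>Re w\<bar> \<le> C" "Im w \<ge> Y" for w
    using norm_Ln_le[of "h w / \<beta>"] quot(1)[OF that] by (simp add: g_def)
  have g_der: "(g has_field_derivative (h' w / \<beta>) / (1 + h w / \<beta>)) (at w)"
    if "\<bar>Re w\<bar> \<le> C" "Im w \<ge> Y" for w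
    unfolding g_def using nz[OF that] \<beta>
    by (auto intro!: derivative_eq_intros der simp: divide_simps)
  have g_der_small: "norm ((h' w / \<beta>) / (1 + h w / \<beta>)) \<le> 1/2" if "\<bar>Re w\<bar> \<le> C" "Im w \<ge> Y" for w
  proof -
    have "norm (h' w / \<beta>) \<le> 1/2 * norm (1 + h w / \<beta>)"
      using quot(2)[OF that] nz(2)[OF that] by linarith
    moreover have "norm (1 + h w / \<beta>) > 0" using nz(2)[OF that] by linarith
    ultimately show ?thesis by (subst norm_divide, subst pos_divide_le_eq)
  qed
  have zero_iff: "exp w + \<beta> + h w = 0 \<longleftrightarrow> (\<exists>n::int. w = \<alpha> + g w + of_int (2 * n) * pi * \<i>)"
    if "\<bar>Re w\<bar> \<le> C" "Im w \<ge> Y" for w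
  proof -
    have "1 + h w / \<beta> \<noteq> 0" using nz(2)[OF that] by auto
    then have "exp (\<alpha> + g w) = -\<beta> * (1 + h w / \<beta>)"
      by (simp add: exp_add exp\<alpha> g_def)
    also have "\<dots> = -\<beta> - h w" using \<beta> by (simp add: field_simps)
    finally have "exp w + \<beta> + h w = exp w - exp (\<alpha> + g w)" by simp
    then have "exp w + \<beta> + h w = 0 \<longleftrightarrow> exp w = exp (\<alpha> + g w)"
      by (metis right_minus_eq)
    then show ?thesis by (simp add: exp_eq)
  qed
  \<comment> \<open>The zeros of the unperturbed function \<open>exp w + \<beta>\<close>.\<close>
  define c where "c k = \<alpha> + 2 * pi * real k * \<i>" for k :: nat
  \<comment> \<open>From this index on the unit disc around \<open>c k\<close> lies above height \<open>Y\<close>.\<close>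
  define N where "N = nat \<lceil>\<bar>Y\<bar> + norm \<alpha> + 1\<rceil>"
  have N: "2 * pi * real k \<ge> Y + norm \<alpha> + 1" if "k \<ge> N" for k
  proof -
    have "real k \<ge> \<bar>Y\<bar> + norm \<alpha> + 1"
      using that unfolding N_def by linarith
    moreover have "2 * pi * real k \<ge> 1 * real k"
      using pi_gt3 by (intro mult_right_mono) auto
    ultimately show ?thesis by linarith
  qed
  have disc: "\<bar>Re w\<bar> \<le> C" "Im w \<ge> Y" if k: "k \<ge> N" and w: "w \<in> cball (c k) 1" for k w
  proof -
    have "\<bar>Re (w - c k)\<bar> \<le> 1" "\<bar>Im (w - c k)\<bar> \<le> 1"
      using w abs_Re_le_cmod[of "w - c k"] abs_Im_le_cmod[of "w - c k"]
      by (auto simp: dist_norm norm_minus_commute)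
    then show "\<bar>Re w\<bar> \<le> C" "Im w \<ge> Y"
      using C N[OF k] abs_Re_le_cmod[of \<alpha>] abs_Im_le_cmod[of \<alpha>]
      by (auto simp: c_def \<alpha>_def)
  qed
  have unique: "\<exists>!w. w \<in> cball (c k) 1 \<and> c k + g w = w" if k: "k \<ge> N" for k
  proof (rule Banach_fix[where c = "1/2"])
    show "(\<lambda>w. c k + g w) ` cball (c k) 1 \<subseteq> cball (c k) 1"
    proof (clarify, rule mem_cball[THEN iffD2])
      fix w assume "w \<in> cball (c k) 1"
      then show "dist (c k) (c k + g w) \<le> 1"
        using g_small[OF disc[OF k]] by (force simp: dist_norm)
    qed
    show "dist (c k + g v) (c k + g w) \<le> 1/2 * dist v w"
      if "v \<in> cball (c k) 1" "w \<in> cball (c k) 1" for v w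
    proof -
      have "norm (g v - g w) \<le> 1/2 * norm (v - w)"
        by (rule field_differentiable_bound[OF convex_cball _ _ that])
          (use g_der g_der_small disc[OF k] DERIV_subset in blast)+
      then show ?thesis by (simp add: dist_norm)
    qed
  qed (auto simp: compact_imp_complete)
  define \<omega> where "\<omega> k = (THE w. w \<in> cball (c k) 1 \<and> c k + g w = w)" for k
  have \<omega>: "\<omega> k \<in> cball (c k) 1" "c k + g (\<omega> k) = \<omega> k" if "k \<ge> N" for k
    using theI'[OF unique[OF that]] unfolding \<omega>_def by auto
  show thesis
  proof
    show "exp (\<omega> k) + \<beta> + h (\<omega> k) = 0" if k: "k \<ge> N" for k
      using \<omega>[OF k] zero_iff[OF disc[OF k \<omega>(1)[OF k]]]
      by (auto simp: c_def algebra_simps intro!: exI[of _ "int k"])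
    show "norm (\<omega> k - 2 * pi * real k * \<i>) \<le> C" if k: "k \<ge> N" for k
    proof -
      have "\<omega> k - 2 * pi * real k * \<i> = (\<omega> k - c k) + \<alpha>" by (simp add: c_def)
      then have "norm (\<omega> k - 2 * pi * real k * \<i>) \<le> norm (\<omega> k - c k) + norm \<alpha>"
        by (metis norm_triangle_ineq)
      also have "norm (\<omega> k - c k) \<le> 1"
        using \<omega>(1)[OF k] by (simp add: dist_norm norm_minus_commute)
      finally show ?thesis using C by (simp add: \<alpha>_def)
    qed
    show "inj_on \<omega> {N..}"
    proof (rule inj_onI)
      fix j k assume *: "j \<in> {N..}" "k \<in> {N..}" "\<omega> j = \<omega> k"
      \<comment> \<open>Equal zeros have equal values of \<open>g\<close>, so the fixed point equations give equal centres.\<close>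
      then have "c j = c k"
        using \<omega>(2)[of j] \<omega>(2)[of k] by (metis add_right_cancel atLeast_iff)
      then show "j = k" by (simp add: c_def)
    qed
    show "w \<in> \<omega> ` {N..} \<and> exp w + h' w \<noteq> 0"
      \<comment> \<open>The additional height excludes the zeros that belong to integers below \<open>N\<close>.\<close>
      if w: "\<bar>Re w\<bar> \<le> C" "Im w \<ge> max Y (2 * pi * real N + norm \<alpha> + 1)" "exp w + \<beta> + h w = 0" for w
    proof
      have wY: "Im w \<ge> Y" using w by simp
      obtain n :: int where n: "w = \<alpha> + g w + of_int (2 * n) * pi * \<i>"
        using zero_iff[OF w(1) wY] w(3) by blast
      have "Im w = Im \<alpha> + Im (g w) + 2 * pi * n"
        using arg_cong[OF n, of Im] by simp
      then have "2 * pi * n \<ge> 2 * pi * real N"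
        using w(2) g_small[OF w(1) wY] abs_Im_le_cmod[of \<alpha>] abs_Im_le_cmod[of "g w"] by linarith
      then have "real_of_int n \<ge> real N" by simp
      then have nN: "n \<ge> int N" by linarith
      then obtain k where k: "n = int k" "k \<ge> N"
        by (metis nat_int nat_le_iff nonneg_int_cases of_nat_0_le_iff order_trans of_nat_le_iff)
      have fw: "c k + g w = w" using n k by (simp add: c_def algebra_simps)
      moreover have "w \<in> cball (c k) 1"
        proof -
        have "w - c k = g w" using fw by (simp add: algebra_simps)
        then show ?thesis
          using g_small[OF w(1) wY] by (simp add: dist_norm norm_minus_commute)
      qed
      ultimately have "w = \<omega> k" using unique[OF k(2)] \<omega>[OF k(2)] by blast
      then show "w \<in> \<omega> ` {N..}" using k by auto
      show "exp w + h' w \<noteq> 0"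
      proof
        \<comment> \<open>A double zero would give \<open>\<beta> = h' w - h w\<close>, but both values of the perturbation are small.\<close>
        assume "exp w + h' w = 0"
        then have "(exp w + \<beta> + h w) - (exp w + h' w) = 0" using w(3) by simp
        then have "\<beta> = h' w - h w" by (simp add: algebra_simps)
        then have "norm \<beta> \<le> norm (h' w) + norm (h w)" using norm_triangle_ineq4 by blast
        also have "\<dots> \<le> norm \<beta> / 4 + norm \<beta> / 4" using Y[OF w(1) wY] by linarith
        finally show False using \<beta> by simp
      qed
    qed
  qed
qed

section \<open>Location of the zeros of large modulus\<close>

definition frequency_sum :: "complex set \<Rightarrow> (complex \<Rightarrow> complex) \<Rightarrow> complex \<Rightarrow> complex" where
  "frequency_sum S D z = (\<Sum>p\<in>S. D p * exp (z * cnj p))"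

text \<open>For \<open>d = p - q\<close> this is a half strip of width \<open>2 * C / norm d\<close> around the ray from the origin in the
direction of the outer normal \<open>\<i> * d\<close>.  The real part of \<open>z * cnj d\<close> compares the moduli of the
exponentials with frequencies \<open>p\<close> and \<open>q\<close>, and the imaginary part is proportional to the
distance along the ray.\<close>
definition edge_strip :: "real \<Rightarrow> real \<Rightarrow> complex \<Rightarrow> complex set" where
  "edge_strip C Y d = {z. \<bar>Re (z * cnj d)\<bar> \<le> C \<and> Y \<le> Im (z * cnj d)}"

text \<open>In terms of the strip coordinate \<open>w = z * cnj d\<close>, the exponential with frequency \<open>v\<close> is
\<open>exp (w * \<mu>)\<close> with \<open>\<mu> = cnj (v / d)\<close>.\<close>
lemma mult_cnj_eq_strip_coordinate:
  assumes "d \<noteq> 0"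
  shows "z * cnj v = (z * cnj d) * cnj (v / d)"
  using assms by simp

lemma Im_divide_eq_inner: "Im (v / d) = ((\<i> * d) \<bullet> v) / (norm d)\<^sup>2"
  by (simp add: Im_divide inner_complex_def cmod_power2 algebra_simps)

text \<open>At a zero the largest exponential is cancelled by the others, so one of them must have
comparable modulus; the constant only depends on the number of terms and the size of the coefficients.\<close>
lemma two_terms_dominate_at_zero:
  assumes S: "finite S" "S \<noteq> {}" and D: "\<And>p. p \<in> S \<Longrightarrow> D p \<noteq> 0"
  obtains C where "C \<ge> 0"
    "\<And>z. frequency_sum S D z = 0 \<Longrightarrow> \<exists>p\<in>S. \<exists>q\<in>S. p \<noteq> q \<and>
       (\<forall>c\<in>S. Re (z * cnj c) \<le> Re (z * cnj p) + C \<and> Re (z * cnj c) \<le> Re (z * cnj q) + C)"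
proof -
  define m where "m = Min ((\<lambda>p. norm (D p)) ` S)"
  define M where "M = Max ((\<lambda>p. norm (D p)) ` S)"
  have mM: "m \<le> norm (D p)" "norm (D p) \<le> M" if "p \<in> S" for p
    using S that by (auto simp: m_def M_def)
  have m0: "m > 0"
    using S D by (auto simp: m_def)
  have n0: "real (card S) \<ge> 1" using S by (simp add: Suc_leI card_gt_0_iff)
  have "m \<le> M" using mM S(2) by (meson all_not_in_conv order_trans)
  \<comment> \<open>If all other exponentials were smaller than the largest one, \<open>x\<close> in modulus, by the factor \<open>r\<close>,
    their terms would have modulus at most \<open>m / card S * x\<close> each.  As there are only \<open>card S - 1\<close> of them,
    they could not cancel the largest term, of modulus at least \<open>m * x\<close>.\<close>
  define r where "r = card S * M / m"
  have r1: "r \<ge> 1"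
  proof -
    have "1 * m \<le> card S * M" using n0 \<open>m \<le> M\<close> m0 by (intro mult_mono) auto
    then show ?thesis using m0 by (simp add: r_def)
  qed
  show thesis
  proof
    show "ln r \<ge> 0" using r1 by simp
    fix z assume zero: "frequency_sum S D z = 0"
    define f where "f c = Re (z * cnj c)" for c
    have "Max (f ` S) \<in> f ` S" using S by (intro Max_in) auto
    then obtain q where "q \<in> S" "f q = Max (f ` S)" by auto
    moreover have "f c \<le> Max (f ` S)" if "c \<in> S" for c using S that by simp
    ultimately have q: "q \<in> S" "\<And>c. c \<in> S \<Longrightarrow> Re (z * cnj c) \<le> Re (z * cnj q)"
      unfolding f_def by auto
    define x where "x = exp (Re (z * cnj q))"
    have "\<exists>p\<in>S - {q}. Re (z * cnj q) \<le> Re (z * cnj p) + ln r"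
    proof (rule ccontr)
      assume neg: "\<not> ?thesis"
      have "D q * exp (z * cnj q) = - (\<Sum>c\<in>S - {q}. D c * exp (z * cnj c))"
        using zero S(1) q(1) by (simp add: frequency_sum_def sum.remove eq_neg_iff_add_eq_0)
      then have "norm (D q) * x = norm (\<Sum>c\<in>S - {q}. D c * exp (z * cnj c))"
        by (metis norm_exp_eq_Re norm_minus_cancel norm_mult x_def)
      also have "\<dots> \<le> (\<Sum>c\<in>S - {q}. m / card S * x)"
      proof (rule order_trans[OF norm_sum sum_mono])
        fix c assume c: "c \<in> S - {q}"
        have "Re (z * cnj c) \<le> Re (z * cnj q) - ln r" using neg c by force
        then have "exp (Re (z * cnj c)) \<le> exp (Re (z * cnj q) - ln r)" by simp
        also have "\<dots> = x / r" using r1 by (simp add: exp_diff x_def)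
        finally have "norm (D c) * exp (Re (z * cnj c)) \<le> M * (x / r)"
          using c mM[of c] by (intro mult_mono) (auto intro: order_trans[OF norm_ge_zero])
        also have "\<dots> = m / card S * x"
          using m0 n0 \<open>m \<le> M\<close> by (simp add: r_def)
        finally show "norm (D c * exp (z * cnj c)) \<le> m / card S * x"
          by (simp add: norm_mult)
      qed
      also have "\<dots> = (real (card S) - 1) / card S * (m * x)"
        using S q(1) n0 by (simp add: card_Diff_singleton of_nat_diff)
      also have "\<dots> < 1 * (m * x)"
        using n0 m0 by (intro mult_strict_right_mono) (auto simp: x_def divide_simps)
      also have "\<dots> \<le> norm (D q) * x"
        using mM[OF q(1)] by (simp add: x_def)
      finally show False by simp
    qed
    then obtain p where p: "p \<in> S" "p \<noteq> q" "Re (z * cnj q) \<le> Re (z * cnj p) + ln r" by blast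
    have "ln r \<ge> 0" using r1 by simp
    then have "\<forall>c\<in>S. Re (z * cnj c) \<le> Re (z * cnj p) + ln r \<and> Re (z * cnj c) \<le> Re (z * cnj q) + ln r"
      using p(3) q(2) by fastforce
    then show "\<exists>p\<in>S. \<exists>q\<in>S. p \<noteq> q \<and>
       (\<forall>c\<in>S. Re (z * cnj c) \<le> Re (z * cnj p) + ln r \<and> Re (z * cnj c) \<le> Re (z * cnj q) + ln r)"
      using p q by blast
  qed
qed

text \<open>If \<open>(p, q)\<close> is not an edge, some \<open>c\<close> lies strictly beyond the line through \<open>p\<close> and \<open>q\<close> in the normal
direction \<open>\<i> * (p - q)\<close>, and far out in the strip its exponential exceeds that of \<open>q\<close> by any given factor.\<close>
lemma dominant_pair_is_oriented_edge:
  assumes pq: "p \<in> S" "q \<in> S" "p \<noteq> q"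
  shows "\<forall>\<^sub>F Y in at_top. \<forall>z\<in>edge_strip C Y (p - q).
    (\<forall>c\<in>S. Re (z * cnj c) \<le> Re (z * cnj q) + C) \<longrightarrow> (p, q) \<in> oriented_edges S"
proof (cases "(p, q) \<in> oriented_edges S")
  case False
  then obtain c where c: "c \<in> S" "(\<i> * (p - q)) \<bullet> (c - q) > 0"
    using pq by (auto simp: oriented_edges_def not_le)
  define \<mu> where "\<mu> = (c - q) / (p - q)"
  have \<mu>: "Im \<mu> > 0" using c pq by (simp add: \<mu>_def Im_divide_eq_inner)
  have "\<not> (\<forall>c\<in>S. Re (z * cnj c) \<le> Re (z * cnj q) + C)"
    if Y: "Y > (C + C * \<bar>Re \<mu>\<bar>) / Im \<mu>" and z: "z \<in> edge_strip C Y (p - q)" for Y z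
  proof
    assume "\<forall>c\<in>S. Re (z * cnj c) \<le> Re (z * cnj q) + C"
    then have "Re (z * cnj (c - q)) \<le> C"
      using c(1) by (auto simp: algebra_simps)
    moreover define w where "w = z * cnj (p - q)"
    ultimately have "Re (w * cnj \<mu>) \<le> C"
      using mult_cnj_eq_strip_coordinate[of "p - q" z "c - q"] pq(3) by (simp add: \<mu>_def w_def)
    then have "Re w * Re \<mu> + Im w * Im \<mu> \<le> C" by simp
    moreover have w: "\<bar>Re w\<bar> \<le> C" "Im w \<ge> Y" using z by (auto simp: edge_strip_def w_def)
    then have "\<bar>Re w * Re \<mu>\<bar> \<le> C * \<bar>Re \<mu>\<bar>"
      unfolding abs_mult by (intro mult_right_mono) auto
    moreover have "Y * Im \<mu> \<le> Im w * Im \<mu>" using w \<mu> by simp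
    ultimately have "Y * Im \<mu> \<le> C + C * \<bar>Re \<mu>\<bar>" by linarith
    then show False using Y \<mu> by (simp add: pos_divide_less_eq)
  qed
  then have "\<forall>z\<in>edge_strip C Y (p - q).
      (\<forall>c\<in>S. Re (z * cnj c) \<le> Re (z * cnj q) + C) \<longrightarrow> (p, q) \<in> oriented_edges S"
    if "Y > (C + C * \<bar>Re \<mu>\<bar>) / Im \<mu>" for Y
    using that by blast
  then show ?thesis
    by (rule eventually_mono[OF eventually_gt_at_top])
next
  case True
  then show ?thesis by simp
qed

text \<open>The two terms that dominate at a zero \<open>z\<close> have frequencies \<open>p\<close>, \<open>q\<close> with \<open>Re (z * cnj (p - q))\<close> bounded, so
\<open>z\<close> can be large only if the imaginary part of this product is large; its sign selects the
order of \<open>p\<close> and \<open>q\<close> for which \<open>z\<close> is far out in a half strip.\<close>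
lemma large_zero_in_edge_strip:
  assumes S: "finite S" "S \<noteq> {}" and D: "\<And>p. p \<in> S \<Longrightarrow> D p \<noteq> 0"
  obtains C0 where "\<And>C Y. C \<ge> C0 \<Longrightarrow> \<exists>\<rho>. \<forall>z. frequency_sum S D z = 0 \<longrightarrow> norm z \<ge> \<rho> \<longrightarrow>
    (\<exists>(p, q)\<in>oriented_edges S. z \<in> edge_strip C Y (p - q))"
proof -
  obtain C0 where C0: "C0 \<ge> 0"
    "\<And>z. frequency_sum S D z = 0 \<Longrightarrow> \<exists>p\<in>S. \<exists>q\<in>S. p \<noteq> q \<and>
       (\<forall>c\<in>S. Re (z * cnj c) \<le> Re (z * cnj p) + C0 \<and> Re (z * cnj c) \<le> Re (z * cnj q) + C0)"
    by (rule two_terms_dominate_at_zero[OF S, of D], erule D, rule that)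
  have "\<exists>\<rho>. \<forall>z. frequency_sum S D z = 0 \<longrightarrow> norm z \<ge> \<rho> \<longrightarrow>
    (\<exists>(p, q)\<in>oriented_edges S. z \<in> edge_strip C Y (p - q))" if C: "C \<ge> C0" for C Y
  proof -
    define Q where "Q = {(p, q). p \<in> S \<and> q \<in> S \<and> p \<noteq> q}"
    have fin: "finite Q"
      by (rule finite_subset[of _ "S \<times> S"]) (use S in \<open>auto simp: Q_def\<close>)
    define good where "good Y' pq \<longleftrightarrow> (\<forall>z\<in>edge_strip C Y' (fst pq - snd pq).
      (\<forall>c\<in>S. Re (z * cnj c) \<le> Re (z * cnj (snd pq)) + C) \<longrightarrow> pq \<in> oriented_edges S)" for Y' pq
    have "\<forall>\<^sub>F Y' in at_top. \<forall>pq\<in>Q. good Y' pq"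
    proof (rule eventually_ball_finite[OF fin], rule ballI)
      fix pq assume "pq \<in> Q"
      then have "fst pq \<in> S" "snd pq \<in> S" "fst pq \<noteq> snd pq" by (auto simp: Q_def)
      from dominant_pair_is_oriented_edge[OF this, of C]
      show "\<forall>\<^sub>F Y' in at_top. good Y' pq" unfolding good_def by simp
    qed
    then have "\<forall>\<^sub>F Y' in at_top. Y' > 0 \<and> Y' \<ge> Y \<and> (\<forall>pq\<in>Q. good Y' pq)"
      using eventually_gt_at_top[of 0] eventually_ge_at_top[of Y] by eventually_elim auto
    then have "\<exists>Y'. Y' > 0 \<and> Y' \<ge> Y \<and> (\<forall>pq\<in>Q. good Y' pq)"
      by (rule eventually_happens'[OF trivial_limit_at_top_linorder])
    then obtain Y' where Y': "Y' > 0" "Y' \<ge> Y" and good: "\<And>pq. pq \<in> Q \<Longrightarrow> good Y' pq" by blast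
    have edge: "(p, q) \<in> oriented_edges S"
      if "p \<in> S" "q \<in> S" "p \<noteq> q" "z \<in> edge_strip C Y' (p - q)"
        "\<And>c. c \<in> S \<Longrightarrow> Re (z * cnj c) \<le> Re (z * cnj q) + C" for p q z
      using good[of "(p, q)"] that by (auto simp: Q_def good_def)
    have "\<forall>\<^sub>F \<rho> in at_top. \<forall>pq\<in>Q. C + Y' \<le> \<rho> * norm (fst pq - snd pq)"
    proof (rule eventually_ball_finite[OF fin], rule ballI)
      fix pq assume "pq \<in> Q"
      then have "norm (fst pq - snd pq) > 0" by (auto simp: Q_def)
      then show "\<forall>\<^sub>F \<rho> in at_top. C + Y' \<le> \<rho> * norm (fst pq - snd pq)"
        by (simp only: pos_divide_le_eq[symmetric] eventually_ge_at_top)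
    qed
    then have "\<exists>\<rho>. \<forall>pq\<in>Q. C + Y' \<le> \<rho> * norm (fst pq - snd pq)"
      by (rule eventually_happens'[OF trivial_limit_at_top_linorder])
    then obtain \<rho> where "\<forall>pq\<in>Q. C + Y' \<le> \<rho> * norm (fst pq - snd pq)" by blast
    then have \<rho>: "C + Y' \<le> \<rho> * norm (p - q)" if "p \<in> S" "q \<in> S" "p \<noteq> q" for p q
      using that by (auto simp: Q_def)
    have "\<exists>(p, q)\<in>oriented_edges S. z \<in> edge_strip C Y (p - q)"
      if zero: "frequency_sum S D z = 0" and z: "norm z \<ge> \<rho>" for z
    proof -
      obtain p q where pq: "p \<in> S" "q \<in> S" "p \<noteq> q"
        and "\<And>c. c \<in> S \<Longrightarrow> Re (z * cnj c) \<le> Re (z * cnj p) + C0"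
        and "\<And>c. c \<in> S \<Longrightarrow> Re (z * cnj c) \<le> Re (z * cnj q) + C0"
        using C0(2)[OF zero] by blast
      then have dom: "\<And>c. c \<in> S \<Longrightarrow> Re (z * cnj c) \<le> Re (z * cnj p) + C"
        "\<And>c. c \<in> S \<Longrightarrow> Re (z * cnj c) \<le> Re (z * cnj q) + C"
        using C by (meson add_left_mono order_trans)+
      define w where "w = z * cnj (p - q)"
      have w': "z * cnj (q - p) = - w" by (simp add: w_def algebra_simps)
      have Re_w: "\<bar>Re w\<bar> \<le> C"
        using dom(1)[OF pq(2)] dom(2)[OF pq(1)] by (simp add: w_def algebra_simps abs_le_iff)
      have "C + Y' \<le> \<rho> * norm (p - q)" using \<rho> pq by blast
      also have "\<dots> \<le> norm z * norm (p - q)" using z by (intro mult_right_mono) auto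
      also have "\<dots> = norm w" by (simp add: w_def norm_mult del: complex_cnj_diff)
      also have "\<dots> \<le> \<bar>Re w\<bar> + \<bar>Im w\<bar>" by (rule cmod_le)
      finally have "Im w \<ge> Y' \<or> - Im w \<ge> Y'" using Re_w by linarith
      then have "z \<in> edge_strip C Y' (p - q) \<or> z \<in> edge_strip C Y' (q - p)"
        using Re_w unfolding edge_strip_def mem_Collect_eq w' w_def[symmetric] by auto
      then have "\<exists>(p, q)\<in>oriented_edges S. z \<in> edge_strip C Y' (p - q)"
        using edge[OF pq] edge[OF pq(2,1)] dom pq(3) by blast
      then show ?thesis using Y'(2) by (fastforce simp: edge_strip_def)
    qed
    then show ?thesis by blast
  qed
  then show thesis using that by blast
qed

text \<open>The real part of \<open>w * \<mu>\<close> is bounded by a constant minus \<open>Im w * Im \<mu>\<close> while \<open>Re w\<close> stays bounded.\<close>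
lemma exponential_decay_in_strip:
  assumes "Im \<mu> > 0"
  shows "\<forall>\<^sub>F Y in at_top. \<forall>w. \<bar>Re w\<bar> \<le> C \<longrightarrow> Im w \<ge> Y \<longrightarrow> Re (w * \<mu>) \<le> - K"
  using eventually_ge_at_top[of "(C * \<bar>Re \<mu>\<bar> + K) / Im \<mu>"]
proof eventually_elim
  case (elim Y)
  show ?case
  proof (intro allI impI)
    fix w assume w: "\<bar>Re w\<bar> \<le> C" "Im w \<ge> Y"
    have "\<bar>Re w * Re \<mu>\<bar> \<le> C * \<bar>Re \<mu>\<bar>"
      unfolding abs_mult using w by (intro mult_right_mono) auto
    moreover have "C * \<bar>Re \<mu>\<bar> + K \<le> Y * Im \<mu>"
      using elim assms by (simp add: pos_divide_le_eq)
    moreover have "Y * Im \<mu> \<le> Im w * Im \<mu>" using w assms by simp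
    ultimately show "Re (w * \<mu>) \<le> - K" by simp
  qed
qed

lemma Im_cnj_divide_pos:
  assumes "edges_without_inner_points S" "(p, q) \<in> oriented_edges S" "c \<in> S - {p, q}"
  shows "Im (cnj ((c - q) / (p - q))) > 0"
proof -
  have "p \<noteq> q" using assms(2) by (auto simp: oriented_edges_def)
  then have "Im ((c - q) / (p - q)) < 0"
    using edges_without_inner_pointsD[OF assms(1,2), of c] assms(3)
    unfolding Im_divide_eq_inner by (intro divide_neg_pos) auto
  moreover have "Im (cnj v) = - Im v" for v by simp
  ultimately show ?thesis by (metis neg_0_less_iff_less)
qed

lemma other_terms_small_in_edge_strip:
  assumes S: "finite S" "edges_without_inner_points S"
  shows "\<forall>\<^sub>F Y in at_top. \<forall>(p, q)\<in>oriented_edges S. \<forall>c\<in>S - {p, q}. \<forall>z\<in>edge_strip C Y (p - q).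
    Re (z * cnj c) \<le> Re (z * cnj q) - K"
proof -
  have "\<forall>\<^sub>F Y in at_top. \<forall>c\<in>S - {p, q}. \<forall>z\<in>edge_strip C Y (p - q). Re (z * cnj c) \<le> Re (z * cnj q) - K"
    if pq: "(p, q) \<in> oriented_edges S" for p q
  proof (rule eventually_ball_finite)
  have "p \<noteq> q" using pq by (auto simp: oriented_edges_def)
  show "\<forall>c\<in>S - {p, q}. \<forall>\<^sub>F Y in at_top. \<forall>z\<in>edge_strip C Y (p - q). Re (z * cnj c) \<le> Re (z * cnj q) - K"
  proof
    fix c assume c: "c \<in> S - {p, q}"
    show "\<forall>\<^sub>F Y in at_top. \<forall>z\<in>edge_strip C Y (p - q). Re (z * cnj c) \<le> Re (z * cnj q) - K"
      using exponential_decay_in_strip[OF Im_cnj_divide_pos[OF S(2) pq c], of C K]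
    proof eventually_elim
      case (elim Y)
      show ?case
      proof
        fix z assume "z \<in> edge_strip C Y (p - q)"
        then have "Re (z * cnj (p - q) * cnj ((c - q) / (p - q))) \<le> - K"
          using elim unfolding edge_strip_def by blast
        moreover have "z * cnj (c - q) = z * cnj (p - q) * cnj ((c - q) / (p - q))"
          by (rule mult_cnj_eq_strip_coordinate) (use \<open>p \<noteq> q\<close> in simp)
        ultimately have "Re (z * cnj (c - q)) \<le> - K" by (simp only:)
        then show "Re (z * cnj c) \<le> Re (z * cnj q) - K" by (simp add: algebra_simps)
      qed
    qed
  qed
  qed (use S in auto)
  then show ?thesis
    by (intro eventually_ball_finite[OF oriented_edges_finite[OF S(1)]]) auto
qed

text \<open>Far out in a half strip, the frequencies whose exponentials are of maximal order are exactly the two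
endpoints of its edge.  A common point of two half strips therefore forces the same endpoints, and
in the same order because the imaginary part of the strip coordinate is positive.\<close>
lemma edge_strips_disjoint:
  assumes S: "finite S" "edges_without_inner_points S" and C: "C \<ge> 0"
  shows "\<forall>\<^sub>F Y in at_top. \<forall>(p, q)\<in>oriented_edges S. \<forall>(p', q')\<in>oriented_edges S.
    edge_strip C Y (p - q) \<inter> edge_strip C Y (p' - q') \<noteq> {} \<longrightarrow> (p, q) = (p', q')"
  using other_terms_small_in_edge_strip[OF S, of C "2 * C + 1"] eventually_gt_at_top[of 0]
proof eventually_elim
  case (elim Y)
  have small: "Re (z * cnj c) \<le> Re (z * cnj q) - (2 * C + 1)"
    if "(p, q) \<in> oriented_edges S" "c \<in> S" "c \<notin> {p, q}" "z \<in> edge_strip C Y (p - q)" for p q c z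
    using elim(1) that by fast
  have comparable: "Re (z * cnj a) \<le> Re (z * cnj b) + C"
    if "z \<in> edge_strip C Y (p - q)" "a \<in> {p, q}" "b \<in> {p, q}" for p q z a b
    using that C by (auto simp: edge_strip_def algebra_simps)
  have sub: "{p', q'} \<subseteq> {p, q}"
    if pq: "(p, q) \<in> oriented_edges S" "(p', q') \<in> oriented_edges S"
      and z: "z \<in> edge_strip C Y (p - q)" "z \<in> edge_strip C Y (p' - q')" for p q p' q' z
  proof (rule ccontr)
    assume "\<not> ?thesis"
    then obtain c where c: "c \<in> {p', q'}" "c \<notin> {p, q}" by blast
    have S: "p \<in> S" "q \<in> S" "p' \<in> S" "q' \<in> S" using pq by (auto simp: oriented_edges_def)
    have 1: "Re (z * cnj c) \<le> Re (z * cnj q) - (2 * C + 1)"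
      using small[OF pq(1) _ c(2) z(1)] c(1) S by blast
    have 2: "Re (z * cnj q') \<le> Re (z * cnj c) + C"
      using comparable[OF z(2)] c(1) by blast
    have "Re (z * cnj q) \<le> Re (z * cnj q') + C"
    proof (cases "q \<in> {p', q'}")
      case True
      then show ?thesis using comparable[OF z(2)] by blast
    next
      case False
      then show ?thesis using small[OF pq(2) S(2) False z(2)] C by linarith
    qed
    then show False using 1 2 by linarith
  qed
  have "(p, q) = (p', q')"
    if pq: "(p, q) \<in> oriented_edges S" "(p', q') \<in> oriented_edges S"
      and z: "z \<in> edge_strip C Y (p - q)" "z \<in> edge_strip C Y (p' - q')" for p q p' q' z
  proof (rule ccontr)
    assume "(p, q) \<noteq> (p', q')"
    then have "p' = q" "q' = p"
      using sub[OF pq z] pq by (auto simp: oriented_edges_def)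
    then have "z * cnj (p' - q') = - (z * cnj (p - q))" by (simp add: algebra_simps)
    then have "Im (z * cnj (p' - q')) = - Im (z * cnj (p - q))" by simp
    then show False using z elim(2) by (simp add: edge_strip_def del: complex_cnj_diff)
  qed
  then show ?case by blast
qed

section \<open>The sequence of zeros belonging to an edge\<close>

text \<open>Dividing the sum by the term of frequency \<open>q\<close>, up to a constant, turns it into \<open>exp w + \<beta> + h w\<close> in the
strip coordinate \<open>w\<close>, where \<open>h\<close> collects the frequencies off the edge.\<close>
lemma edge_zero_sequence:
  assumes S: "finite S" "edges_without_inner_points S" and pq: "(p, q) \<in> oriented_edges S"
    and D: "D p \<noteq> 0" "D q \<noteq> 0" and C: "norm (Ln (- (D q / D p))) + 1 \<le> C"
  obtains \<zeta> :: "nat \<Rightarrow> complex" and N Y where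
    "\<And>k. k \<ge> N \<Longrightarrow> frequency_sum S D (\<zeta> k) = 0"
    "\<And>k. k \<ge> N \<Longrightarrow> norm (\<zeta> k * cnj (p - q) - 2 * pi * real k * \<i>) \<le> C"
    "inj_on \<zeta> {N..}"
    "\<And>z. z \<in> edge_strip C Y (p - q) \<Longrightarrow> frequency_sum S D z = 0 \<Longrightarrow>
       z \<in> \<zeta> ` {N..} \<and> deriv (frequency_sum S D) z \<noteq> 0"
proof -
  have mem: "p \<in> S" "q \<in> S" "p \<noteq> q" using pq by (auto simp: oriented_edges_def)
  define d where "d = p - q"
  have d: "d \<noteq> 0" "cnj d \<noteq> 0" using mem by (auto simp: d_def)
  define T where "T = S - {p, q}"
  define \<beta> where "\<beta> = D q / D p"
  define \<mu> where "\<mu> c = cnj ((c - q) / d)" for c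
  define \<kappa> where "\<kappa> c = D c / D p" for c
  define h where "h w = (\<Sum>c\<in>T. \<kappa> c * exp (w * \<mu> c))" for w
  define h' where "h' w = (\<Sum>c\<in>T. \<kappa> c * \<mu> c * exp (w * \<mu> c))" for w
  have T: "finite T" using S by (simp add: T_def)
  have \<mu>: "Im (\<mu> c) > 0" if "c \<in> T" for c
    using Im_cnj_divide_pos[OF S(2) pq] that by (simp only: \<mu>_def d_def T_def)
  have der: "(h has_field_derivative h' w) (at w)" for w
    unfolding h_def[abs_def] h'_def by (auto intro!: derivative_eq_intros sum.cong simp: mult_ac)
  have small: "\<exists>Y. \<forall>w. \<bar>Re w\<bar> \<le> C \<longrightarrow> Im w \<ge> Y \<longrightarrow> norm (h w) \<le> \<eta> \<and> norm (h' w) \<le> \<eta>"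
    if \<eta>: "\<eta> > 0" for \<eta>
  proof -
    \<comment> \<open>This bounds the coefficient sums of \<open>h\<close> and of \<open>h'\<close>;
    the summand 1 keeps it positive when \<open>T\<close> is empty.\<close>
    define A where "A = (\<Sum>c\<in>T. norm (\<kappa> c) * (1 + norm (\<mu> c))) + 1"
    have A: "A > 0" unfolding A_def by (intro add_nonneg_pos sum_nonneg) auto
    define K where "K = - ln (\<eta> / A)"
    have "\<forall>\<^sub>F Y in at_top. \<forall>c\<in>T. \<forall>w. \<bar>Re w\<bar> \<le> C \<longrightarrow> Im w \<ge> Y \<longrightarrow> Re (w * \<mu> c) \<le> - K"
      by (rule eventually_ball_finite[OF T]) (use \<mu> exponential_decay_in_strip in blast)
    then have "\<exists>Y. \<forall>c\<in>T. \<forall>w. \<bar>Re w\<bar> \<le> C \<longrightarrow> Im w \<ge> Y \<longrightarrow> Re (w * \<mu> c) \<le> - K"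
      by (rule eventually_happens'[OF trivial_limit_at_top_linorder])
    then obtain Y where Y: "\<forall>c\<in>T. \<forall>w. \<bar>Re w\<bar> \<le> C \<longrightarrow> Im w \<ge> Y \<longrightarrow> Re (w * \<mu> c) \<le> - K"
      by blast
    have "norm (h w) \<le> \<eta> \<and> norm (h' w) \<le> \<eta>" if w: "\<bar>Re w\<bar> \<le> C" "Im w \<ge> Y" for w
    proof -
      have bound: "norm (\<Sum>c\<in>T. a c * exp (w * \<mu> c)) \<le> \<eta>"
        if a: "\<And>c. norm (a c) \<le> norm (\<kappa> c) * (1 + norm (\<mu> c))" for a
      proof -
        have "norm (\<Sum>c\<in>T. a c * exp (w * \<mu> c)) \<le> (\<Sum>c\<in>T. norm (\<kappa> c) * (1 + norm (\<mu> c)) * (\<eta> / A))"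
        proof (rule order_trans[OF norm_sum sum_mono])
          fix c assume "c \<in> T"
          then have "Re (w * \<mu> c) \<le> ln (\<eta> / A)" using Y w unfolding K_def by simp
          then have "exp (Re (w * \<mu> c)) \<le> exp (ln (\<eta> / A))" by (rule exp_le_cancel_iff[THEN iffD2])
          then have "norm (exp (w * \<mu> c)) \<le> \<eta> / A" using \<eta> A by (simp only: norm_exp_eq_Re exp_ln divide_pos_pos)
          then show "norm (a c * exp (w * \<mu> c)) \<le> norm (\<kappa> c) * (1 + norm (\<mu> c)) * (\<eta> / A)"
            unfolding norm_mult[of "a c"] using a by (intro mult_mono) auto
        qed
        also have "\<dots> = (A - 1) * (\<eta> / A)" by (simp add: A_def sum_distrib_right sum_divide_distrib)
        also have "\<dots> \<le> A * (\<eta> / A)" using \<eta> A by (intro mult_right_mono) auto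
        also have "\<dots> = \<eta>" using A by simp
        finally show ?thesis .
      qed
      show ?thesis
        unfolding h_def h'_def by (intro conjI bound) (simp_all add: norm_mult distrib_left)
    qed
    then show ?thesis by blast
  qed
  have factor: "frequency_sum S D z = D p * exp (z * cnj q) * (exp (z * cnj d) + \<beta> + h (z * cnj d))" for z
  proof -
    have "S = insert p (insert q T)" "p \<notin> insert q T" "q \<notin> T" using mem by (auto simp: T_def)
    then have expand: "frequency_sum S D z
        = D p * exp (z * cnj p) + D q * exp (z * cnj q) + (\<Sum>c\<in>T. D c * exp (z * cnj c))"
      using T by (simp add: frequency_sum_def)
    have rest: "D c * exp (z * cnj c) = D p * exp (z * cnj q) * (\<kappa> c * exp (z * cnj d * \<mu> c))" for c
    proof -
      have "z * cnj d * \<mu> c = z * cnj (c - q)"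
        using mult_cnj_eq_strip_coordinate[OF d(1), of z "c - q"] by (simp only: \<mu>_def)
      then have "exp (z * cnj c) = exp (z * cnj q) * exp (z * cnj d * \<mu> c)"
        by (simp add: exp_add[symmetric] algebra_simps)
      then show ?thesis using D by (simp add: \<kappa>_def)
    qed
    have "(\<Sum>c\<in>T. D c * exp (z * cnj c)) = D p * exp (z * cnj q) * h (z * cnj d)"
      unfolding h_def sum_distrib_left by (rule sum.cong[OF refl rest])
    moreover have "D p * exp (z * cnj p) = D p * exp (z * cnj q) * exp (z * cnj d)"
      by (simp add: exp_add[symmetric] d_def algebra_simps)
    moreover have "D q * exp (z * cnj q) = D p * exp (z * cnj q) * \<beta>"
      using D by (simp add: \<beta>_def)
    ultimately show ?thesis unfolding expand by (simp only: distrib_left)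
  qed
  have \<beta>: "\<beta> \<noteq> 0" using D by (simp add: \<beta>_def)
  have zero_iff: "frequency_sum S D z = 0 \<longleftrightarrow> exp (z * cnj d) + \<beta> + h (z * cnj d) = 0" for z
    unfolding factor using D by simp
  have deriv_zero: "deriv (frequency_sum S D) z
      = D p * exp (z * cnj q) * ((exp (z * cnj d) + h' (z * cnj d)) * cnj d)"
    if "frequency_sum S D z = 0" for z
  proof -
    let ?G = "\<lambda>z. exp (z * cnj d) + \<beta> + h (z * cnj d)"
    have "((\<lambda>z. h (z * cnj d)) has_field_derivative h' (z * cnj d) * cnj d) (at z)"
      by (rule DERIV_chain2[OF der]) (auto intro!: derivative_eq_intros)
    then have G: "(?G has_field_derivative (exp (z * cnj d) + h' (z * cnj d)) * cnj d) (at z)"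
      by (auto intro!: derivative_eq_intros simp: algebra_simps)
    have e: "((\<lambda>z. D p * exp (z * cnj q)) has_field_derivative D p * exp (z * cnj q) * cnj q) (at z)"
      by (auto intro!: derivative_eq_intros)
    have "((\<lambda>z. D p * exp (z * cnj q) * ?G z) has_field_derivative
        D p * exp (z * cnj q) * ((exp (z * cnj d) + h' (z * cnj d)) * cnj d)) (at z)"
      using DERIV_mult[OF e G] that zero_iff[of z] by (simp add: mult_ac)
    moreover have "frequency_sum S D = (\<lambda>z. D p * exp (z * cnj q) * ?G z)"
      by (rule ext) (rule factor)
    ultimately show ?thesis by (simp only: DERIV_imp_deriv)
  qed
  obtain \<omega> :: "nat \<Rightarrow> complex" and N Y where \<omega>:
    "\<And>k. k \<ge> N \<Longrightarrow> exp (\<omega> k) + \<beta> + h (\<omega> k) = 0"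
    "\<And>k. k \<ge> N \<Longrightarrow> norm (\<omega> k - 2 * pi * real k * \<i>) \<le> C"
    "inj_on \<omega> {N..}"
    "\<And>w. \<bar>Re w\<bar> \<le> C \<Longrightarrow> Im w \<ge> Y \<Longrightarrow> exp w + \<beta> + h w = 0 \<Longrightarrow> w \<in> \<omega> ` {N..} \<and> exp w + h' w \<noteq> 0"
    by (rule perturbed_exponential_zeros[OF \<beta>, of h h' C], rule der, erule small,
        rule C[folded \<beta>_def], rule that)
  define \<zeta> where "\<zeta> k = \<omega> k / cnj d" for k
  have \<zeta>: "\<zeta> k * cnj d = \<omega> k" for k using d by (simp add: \<zeta>_def)
  show thesis
  proof
    show "frequency_sum S D (\<zeta> k) = 0" if "k \<ge> N" for k
      using \<omega>(1)[OF that] by (simp only: zero_iff \<zeta>)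
    show "norm (\<zeta> k * cnj (p - q) - 2 * pi * real k * \<i>) \<le> C" if "k \<ge> N" for k
      using \<omega>(2)[OF that] by (simp only: \<zeta> d_def[symmetric])
    show "inj_on \<zeta> {N..}"
      using \<omega>(3) d by (auto simp: inj_on_def \<zeta>_def)
    show "z \<in> \<zeta> ` {N..} \<and> deriv (frequency_sum S D) z \<noteq> 0"
      if z: "z \<in> edge_strip C Y (p - q)" and zero: "frequency_sum S D z = 0" for z
    proof -
      have *: "z * cnj d \<in> \<omega> ` {N..} \<and> exp (z * cnj d) + h' (z * cnj d) \<noteq> 0"
        using \<omega>(4) z zero unfolding edge_strip_def zero_iff d_def[symmetric] by blast
      then obtain k where "k \<ge> N" "z * cnj d = \<omega> k" by auto
      then have "z = \<zeta> k" using d by (simp add: \<zeta>_def field_simps)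
      then show ?thesis
        using * \<open>k \<ge> N\<close> D d unfolding deriv_zero[OF zero] by simp
    qed
  qed
qed

text \<open>The constants of the individual edges are replaced by common ones: one width \<open>C\<close> of all strips,
one height from which on the strips are disjoint and meet each zero sequence in its tail, and one
radius beyond which all zeros are in these tails.\<close>
lemma zero_sequences:
  assumes S: "finite S" "edges_without_inner_points S" "S \<noteq> {}" and D: "\<And>p. p \<in> S \<Longrightarrow> D p \<noteq> 0"
  obtains \<zeta> :: "complex \<times> complex \<Rightarrow> nat \<Rightarrow> complex" and N C \<rho> where
    "\<And>e k. e \<in> oriented_edges S \<Longrightarrow> k \<ge> N \<Longrightarrow> frequency_sum S D (\<zeta> e k) = 0"
    "\<And>e k. e \<in> oriented_edges S \<Longrightarrow> k \<ge> N \<Longrightarrow>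
       \<bar>dist (fst e) (snd e) * norm (\<zeta> e k) - 2 * pi * real k\<bar> \<le> C"
    "inj_on (\<lambda>(e, k). \<zeta> e k) (oriented_edges S \<times> {N..})"
    "\<And>z. frequency_sum S D z = 0 \<Longrightarrow> norm z \<ge> \<rho> \<Longrightarrow>
       (\<exists>e\<in>oriented_edges S. \<exists>k\<ge>N. z = \<zeta> e k) \<and> deriv (frequency_sum S D) z \<noteq> 0"
proof -
  let ?E = "oriented_edges S" and ?F = "frequency_sum S D"
  have fin: "finite ?E" using oriented_edges_finite[OF S(1)] .
  have mem: "fst e \<in> S" "snd e \<in> S" if "e \<in> ?E" for e
    using that by (auto simp: oriented_edges_def)
  obtain C0 where C0: "\<And>C Y. C \<ge> C0 \<Longrightarrow> \<exists>\<rho>. \<forall>z. ?F z = 0 \<longrightarrow> norm z \<ge> \<rho> \<longrightarrow>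
    (\<exists>(p, q)\<in>?E. z \<in> edge_strip C Y (p - q))"
    by (rule large_zero_in_edge_strip[OF S(1,3), of D], erule D, rule that)
  define l where "l e = norm (Ln (- (D (snd e) / D (fst e)))) + 1" for e :: "complex \<times> complex"
  define C where "C = \<bar>C0\<bar> + sum l ?E"
  have l0: "l e \<ge> 0" for e by (simp add: l_def)
  have C: "C \<ge> C0" "C \<ge> 0" unfolding C_def using sum_nonneg[of ?E l] l0 by auto
  have lC: "l e \<le> C" if "e \<in> ?E" for e
    using member_le_sum[OF that _ fin, of l] l0 unfolding C_def by auto
  define strip where "strip Y e = edge_strip C Y (fst e - snd e)" for Y and e :: "complex \<times> complex"
  define good where "good e \<zeta> N Y \<longleftrightarrow> (\<forall>k\<ge>N. ?F (\<zeta> k) = 0) \<and>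
    (\<forall>k\<ge>N. norm (\<zeta> k * cnj (fst e - snd e) - 2 * pi * real k * \<i>) \<le> C) \<and> inj_on \<zeta> {N..} \<and>
    (\<forall>z\<in>strip Y e. ?F z = 0 \<longrightarrow> z \<in> \<zeta> ` {N..} \<and> deriv ?F z \<noteq> 0)" for e \<zeta> N Y
  have "\<exists>\<zeta> N Y. good e \<zeta> N Y" if e: "e \<in> ?E" for e
  proof -
    have "(fst e, snd e) \<in> ?E" using e by simp
    from edge_zero_sequence[OF S(1,2) this D[OF mem(1)[OF e]] D[OF mem(2)[OF e]] lC[OF e, unfolded l_def]]
    show ?thesis unfolding good_def strip_def by (metis (no_types, lifting))
  qed
  then obtain \<zeta> N Y where good: "\<And>e. e \<in> ?E \<Longrightarrow> good e (\<zeta> e) (N e) (Y e)" by metis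
  have "\<forall>\<^sub>F Y' in at_top. \<forall>e\<in>?E. Y e \<le> Y'"
    by (rule eventually_ball_finite[OF fin]) (simp add: eventually_ge_at_top)
  moreover have "\<forall>\<^sub>F Y' in at_top. \<forall>e\<in>?E. \<forall>e'\<in>?E. strip Y' e \<inter> strip Y' e' \<noteq> {} \<longrightarrow> e = e'"
    using edge_strips_disjoint[OF S(1,2) C(2)]
    by eventually_elim (simp add: strip_def case_prod_beta prod_eq_iff)
  ultimately have "\<forall>\<^sub>F Y' in at_top. (\<forall>e\<in>?E. Y e \<le> Y') \<and>
      (\<forall>e\<in>?E. \<forall>e'\<in>?E. strip Y' e \<inter> strip Y' e' \<noteq> {} \<longrightarrow> e = e')"
    by (rule eventually_conj)
  then have "\<exists>Y'. (\<forall>e\<in>?E. Y e \<le> Y') \<and> (\<forall>e\<in>?E. \<forall>e'\<in>?E. strip Y' e \<inter> strip Y' e' \<noteq> {} \<longrightarrow> e = e')"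
    by (rule eventually_happens'[OF trivial_limit_at_top_linorder])
  then obtain Y' where Y': "\<And>e. e \<in> ?E \<Longrightarrow> Y e \<le> Y'"
    and disj: "\<And>e e' z. e \<in> ?E \<Longrightarrow> e' \<in> ?E \<Longrightarrow> z \<in> strip Y' e \<Longrightarrow> z \<in> strip Y' e' \<Longrightarrow> e = e'"
    by blast
  obtain \<rho> where \<rho>: "\<And>z. ?F z = 0 \<Longrightarrow> norm z \<ge> \<rho> \<Longrightarrow> \<exists>e\<in>?E. z \<in> strip Y' e"
    using C0[OF C(1), of Y'] unfolding strip_def by (metis (no_types, lifting) case_prodE prod.sel)
  have strip_mono: "z \<in> strip (Y e) e" if "e \<in> ?E" "z \<in> strip Y' e" for e z
    using that Y'[OF that(1)] unfolding strip_def edge_strip_def by (auto simp del: complex_cnj_diff)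
  define N' where "N' = nat \<lceil>\<bar>Y'\<bar> + C\<rceil> + sum N ?E"
  have N': "N' \<ge> N e" if "e \<in> ?E" for e
    using member_le_sum[OF that _ fin, of N] unfolding N'_def by auto
  have N'_large: "2 * pi * real k - C \<ge> Y'" if "k \<ge> N'" for k
  proof -
    have "real k \<ge> \<bar>Y'\<bar> + C" using that unfolding N'_def by linarith
    moreover have "2 * pi * real k \<ge> 1 * real k" using pi_gt3 by (intro mult_right_mono) auto
    ultimately show ?thesis by linarith
  qed
  have near: "norm (\<zeta> e k * cnj (fst e - snd e) - 2 * pi * real k * \<i>) \<le> C"
    if "e \<in> ?E" "k \<ge> N'" for e k
    using good[OF that(1)] N'[OF that(1)] that(2) unfolding good_def by auto
  have in_strip: "\<zeta> e k \<in> strip Y' e" if "e \<in> ?E" "k \<ge> N'" for e k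
  proof -
    define w where "w = \<zeta> e k * cnj (fst e - snd e)"
    have "\<bar>Re (w - 2 * pi * real k * \<i>)\<bar> \<le> C" "\<bar>Im (w - 2 * pi * real k * \<i>)\<bar> \<le> C"
      using near[OF that] abs_Re_le_cmod abs_Im_le_cmod order_trans unfolding w_def by blast+
    then have "\<bar>Re w\<bar> \<le> C" "Im w \<ge> Y'" using N'_large[OF that(2)] by auto
    then show ?thesis by (simp only: strip_def edge_strip_def w_def mem_Collect_eq simp_thms)
  qed
  \<comment> \<open>Large enough to exclude the finitely many members of the sequences with index below \<open>N'\<close>.\<close>
  define \<rho>' where "\<rho>' = \<bar>\<rho>\<bar> + (\<Sum>e\<in>?E. \<Sum>k<N'. norm (\<zeta> e k)) + 1"
  have \<rho>': "norm (\<zeta> e k) < \<rho>'" if "e \<in> ?E" "k < N'" for e k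
  proof -
    have "norm (\<zeta> e k) \<le> (\<Sum>k<N'. norm (\<zeta> e k))"
      by (rule member_le_sum) (use that in auto)
    also have "\<dots> \<le> (\<Sum>e\<in>?E. \<Sum>k<N'. norm (\<zeta> e k))"
      by (rule member_le_sum[where f = "\<lambda>e. \<Sum>k<N'. norm (\<zeta> e k)"]) (use that fin in \<open>auto intro: sum_nonneg\<close>)
    finally show ?thesis by (simp add: \<rho>'_def)
  qed
  have \<rho>'_ge: "\<rho>' \<ge> \<rho>"
  proof -
    have "(\<Sum>e\<in>?E. \<Sum>k<N'. norm (\<zeta> e k)) \<ge> 0" by (intro sum_nonneg) auto
    then show ?thesis unfolding \<rho>'_def by linarith
  qed
  show thesis
  proof
    show "?F (\<zeta> e k) = 0" if "e \<in> ?E" "k \<ge> N'" for e k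
      using good[OF that(1)] N'[OF that(1)] that(2) unfolding good_def by auto
    show "\<bar>dist (fst e) (snd e) * norm (\<zeta> e k) - 2 * pi * real k\<bar> \<le> C" if "e \<in> ?E" "k \<ge> N'" for e k
    proof -
      have "norm (\<zeta> e k * cnj (fst e - snd e)) = dist (fst e) (snd e) * norm (\<zeta> e k)"
        by (simp add: norm_mult dist_norm mult.commute del: complex_cnj_diff)
      moreover have "norm (2 * pi * real k * \<i>) = 2 * pi * real k" by (simp add: norm_mult)
      ultimately show ?thesis
        using norm_triangle_ineq3[of "\<zeta> e k * cnj (fst e - snd e)" "2 * pi * real k * \<i>"] near[OF that]
        by linarith
    qed
    show "inj_on (\<lambda>(e, k). \<zeta> e k) (?E \<times> {N'..})"
    proof (rule inj_onI)
      fix x y assume xy: "x \<in> ?E \<times> {N'..}" "y \<in> ?E \<times> {N'..}"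
        "(case x of (e, k) \<Rightarrow> \<zeta> e k) = (case y of (e, k) \<Rightarrow> \<zeta> e k)"
      obtain e k e' k' where x: "x = (e, k)" and y: "y = (e', k')" by (cases x, cases y)
      have e: "e \<in> ?E" "e' \<in> ?E" and k: "k \<ge> N'" "k' \<ge> N'" and eq: "\<zeta> e k = \<zeta> e' k'"
        using xy x y by auto
      have "\<zeta> e k \<in> strip Y' e'" using in_strip[OF e(2) k(2)] eq by simp
      then have same: "e = e'" using disj[OF e in_strip[OF e(1) k(1)]] by blast
      have "inj_on (\<zeta> e) {N e..}" using good[OF e(1)] by (simp add: good_def)
      then have "k = k'"
        by (rule inj_onD) (use eq same k N'[OF e(1)] in auto)
      then show "x = y" using same x y by simp
    qed
    show "(\<exists>e\<in>?E. \<exists>k\<ge>N'. z = \<zeta> e k) \<and> deriv ?F z \<noteq> 0" if z: "?F z = 0" "norm z \<ge> \<rho>'" for z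
    proof -
      obtain e where e: "e \<in> ?E" "z \<in> strip Y' e" using \<rho>[OF z(1)] z(2) \<rho>'_ge by fastforce
      have "z \<in> \<zeta> e ` {N e..} \<and> deriv ?F z \<noteq> 0"
        using good[OF e(1)] strip_mono[OF e] z(1) by (simp add: good_def)
      then obtain k where k: "z = \<zeta> e k" and simple: "deriv ?F z \<noteq> 0" by blast
      have "k \<ge> N'" using \<rho>'[OF e(1), of k] z(2) k by (meson not_le)
      then show ?thesis using e(1) k simple by blast
    qed
  qed
qed

section \<open>Counting the zeros\<close>

lemma card_sequence_upto:
  fixes \<zeta> :: "nat \<Rightarrow> complex" and L C E :: real
  assumes L: "L > 0" and E: "E \<ge> 0"
    and bound: "\<And>k. k \<ge> N \<Longrightarrow> \<bar>L * norm (\<zeta> k) - 2 * pi * real k\<bar> \<le> C"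
  shows "finite {k. k \<ge> N \<and> norm (\<zeta> k) \<le> E}"
    and "\<bar>real (card {k. k \<ge> N \<and> norm (\<zeta> k) \<le> E}) - L * E / (2 * pi)\<bar> \<le> C / (2 * pi) + N + 1"
proof -
  let ?K = "{k. k \<ge> N \<and> norm (\<zeta> k) \<le> E}"
  define x where "x = L * E / (2 * pi)"
  define y where "y = C / (2 * pi)"
  have C0: "C \<ge> 0" using bound[of N] by linarith
  then have y0: "y \<ge> 0" by (simp add: y_def)
  have x0: "x \<ge> 0" using L E by (simp add: x_def)
  have up: "real k \<le> x + y" if "k \<in> ?K" for k
  proof -
    have "L * norm (\<zeta> k) \<le> L * E" using that L by (intro mult_left_mono) auto
    then have "2 * pi * real k \<le> L * E + C" using bound[of k] that by simp
    then show ?thesis by (simp add: x_def y_def field_simps)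
  qed
  have sub: "?K \<subseteq> {..nat \<lfloor>x + y\<rfloor>}" using up by (auto simp: le_nat_floor)
  then show "finite ?K" using finite_subset by blast
  have "card ?K \<le> nat \<lfloor>x + y\<rfloor> + 1" using card_mono[OF _ sub] by simp
  then have 1: "real (card ?K) \<le> x + y + 1" using x0 y0 by linarith
  have low: "{N..<nat \<lceil>x - y\<rceil>} \<subseteq> ?K"
  proof
    fix k assume k: "k \<in> {N..<nat \<lceil>x - y\<rceil>}"
    then have "real k \<le> x - y" by (auto simp: less_ceiling_iff zless_nat_eq_int_zless)
    then have "2 * pi * real k + C \<le> L * E" by (simp add: x_def y_def field_simps)
    then have "L * norm (\<zeta> k) \<le> L * E" using bound[of k] k by simp
    then show "k \<in> ?K" using L k by simp
  qed
  have "nat \<lceil>x - y\<rceil> - N \<le> card ?K" using card_mono[OF \<open>finite ?K\<close> low] by simp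
  then have 2: "real (card ?K) \<ge> x - y - N" by linarith
  show "\<bar>real (card ?K) - L * E / (2 * pi)\<bar> \<le> C / (2 * pi) + N + 1"
    using 1 2 y0 unfolding x_def[symmetric] y_def[symmetric] by linarith
qed

text \<open>Every sequence has one member per step of \<open>2 * pi / L p\<close> in modulus, up to a bounded error.  The count
omits the members inside the disc of radius \<open>\<rho>\<close>, but their number does not depend on \<open>E\<close>.\<close>
lemma card_sequences_upto:
  fixes \<zeta> :: "'p \<Rightarrow> nat \<Rightarrow> complex" and L :: "'p \<Rightarrow> real" and C \<rho> :: real and Z :: "complex set"
  assumes P: "finite P" and L: "\<And>p. p \<in> P \<Longrightarrow> L p > 0"
    and bound: "\<And>p k. p \<in> P \<Longrightarrow> k \<ge> N \<Longrightarrow> \<bar>L p * norm (\<zeta> p k) - 2 * pi * real k\<bar> \<le> C"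
    and inj: "inj_on (\<lambda>(p, k). \<zeta> p k) (P \<times> {N..})"
    and Z: "\<And>p k. p \<in> P \<Longrightarrow> k \<ge> N \<Longrightarrow> \<zeta> p k \<in> Z"
    and cover: "\<And>z. z \<in> Z \<Longrightarrow> norm z \<ge> \<rho> \<Longrightarrow> \<exists>p\<in>P. \<exists>k\<ge>N. z = \<zeta> p k"
  obtains B where
    "\<And>E. E \<ge> 0 \<Longrightarrow> finite {z\<in>Z. \<rho> \<le> norm z \<and> norm z \<le> E}"
    "\<And>E. E \<ge> 0 \<Longrightarrow> \<bar>real (card {z\<in>Z. \<rho> \<le> norm z \<and> norm z \<le> E}) - (\<Sum>p\<in>P. L p) * E / (2 * pi)\<bar> \<le> B"
proof -
  define K where "K E p = {k. k \<ge> N \<and> norm (\<zeta> p k) \<le> E}" for E p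
  define W where "W E = (SIGMA p:P. K E p)" for E
  have finK: "finite (K E p)"
    and cardK: "\<bar>real (card (K E p)) - L p * E / (2 * pi)\<bar> \<le> C / (2 * pi) + N + 1"
    if "p \<in> P" "E \<ge> 0" for E p
    using card_sequence_upto[of "L p" E N "\<zeta> p" C] L bound that unfolding K_def by force+
  have finW: "finite (W E)" if "E \<ge> 0" for E
    unfolding W_def using P finK that by auto
  define S where "S E = {z\<in>Z. \<rho> \<le> norm z \<and> norm z \<le> E}" for E
  have sub: "S E \<subseteq> (\<lambda>(p, k). \<zeta> p k) ` W E" for E
    using cover by (force simp: S_def W_def K_def)
  have finS: "finite (S E)" if "E \<ge> 0" for E
    using finite_subset[OF sub] finW[OF that] by blast
  have "\<bar>real (card (S E)) - (\<Sum>p\<in>P. L p) * E / (2 * pi)\<bar>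
      \<le> card (W \<bar>\<rho>\<bar>) + real (card P) * (C / (2 * pi) + N + 1)" if E: "E \<ge> 0" for E
  proof -
    have cW: "card ((\<lambda>(p, k). \<zeta> p k) ` W E) = card (W E)"
      by (rule card_image, rule inj_on_subset[OF inj]) (auto simp: W_def K_def)
    have "card (S E) \<le> card (W E)"
      using card_mono[OF finite_imageI[OF finW[OF E]] sub] cW by simp
    moreover have "(\<lambda>(p, k). \<zeta> p k) ` W E \<subseteq> S E \<union> (\<lambda>(p, k). \<zeta> p k) ` W \<bar>\<rho>\<bar>"
      using Z by (force simp: S_def W_def K_def)
    then have "card (W E) \<le> card (S E \<union> (\<lambda>(p, k). \<zeta> p k) ` W \<bar>\<rho>\<bar>)"
      using cW card_mono finS[OF E] finW[of "\<bar>\<rho>\<bar>"] by (metis abs_ge_zero finite_UnI finite_imageI)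
    then have "card (W E) \<le> card (S E) + card (W \<bar>\<rho>\<bar>)"
      using card_Un_le[of "S E" "(\<lambda>(p, k). \<zeta> p k) ` W \<bar>\<rho>\<bar>"]
        card_image_le[OF finW[of "\<bar>\<rho>\<bar>"], of "\<lambda>(p, k). \<zeta> p k"] by simp
    moreover have "real (card (W E)) = (\<Sum>p\<in>P. real (card (K E p)))"
      unfolding W_def using P finK E by (simp add: card_SigmaI)
    then have "\<bar>real (card (W E)) - (\<Sum>p\<in>P. L p) * E / (2 * pi)\<bar>
        = \<bar>\<Sum>p\<in>P. real (card (K E p)) - L p * E / (2 * pi)\<bar>"
      by (simp add: sum_subtractf sum_distrib_right sum_divide_distrib)
    moreover have "\<dots> \<le> (\<Sum>p\<in>P. C / (2 * pi) + N + 1)"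
      by (rule order_trans[OF sum_abs sum_mono]) (use cardK E in auto)
    ultimately show ?thesis by simp
  qed
  then show thesis using that[OF finS[unfolded S_def]] unfolding S_def by blast
qed

lemma frequency_sum_holomorphic: "frequency_sum S D holomorphic_on A"
  unfolding frequency_sum_def[abs_def] by (intro holomorphic_intros)

lemma zorder_simple_zero:
  assumes "f holomorphic_on UNIV" "f z = 0" "deriv f z \<noteq> 0"
  shows "zorder f z = 1"
proof (rule zorder_zero_eqI')
  show "f analytic_on {z}"
    using assms(1) by (meson analytic_on_holomorphic open_UNIV subset_UNIV)
qed (use assms in auto)

text \<open>Outside a fixed disc all zeros are simple and form the sequences of the edges, so both counts differ
from the number of members of these sequences by a constant.\<close>
theorem frequency_sum_zero_counts:
  assumes S: "finite S" "edges_without_inner_points S" "S \<noteq> {}" and D: "\<And>p. p \<in> S \<Longrightarrow> D p \<noteq> 0"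
  defines "b \<equiv> \<Sum>(p, q)\<in>oriented_edges S. dist p q"
  shows "(\<lambda>E. zero_count_mult (frequency_sum S D) E - b * E / (2 * pi)) \<in> O[at_top](\<lambda>_. 1)"
    and "(\<lambda>E. zero_count (frequency_sum S D) E - b * E / (2 * pi)) \<in> O[at_top](\<lambda>_. 1)"
proof -
  let ?E = "oriented_edges S" and ?F = "frequency_sum S D"
  obtain \<zeta> :: "complex \<times> complex \<Rightarrow> nat \<Rightarrow> complex" and N C \<rho>0 where \<zeta>:
    "\<And>e k. e \<in> ?E \<Longrightarrow> k \<ge> N \<Longrightarrow> ?F (\<zeta> e k) = 0"
    "\<And>e k. e \<in> ?E \<Longrightarrow> k \<ge> N \<Longrightarrow> \<bar>dist (fst e) (snd e) * norm (\<zeta> e k) - 2 * pi * real k\<bar> \<le> C"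
    "inj_on (\<lambda>(e, k). \<zeta> e k) (?E \<times> {N..})"
    "\<And>z. ?F z = 0 \<Longrightarrow> norm z \<ge> \<rho>0 \<Longrightarrow> (\<exists>e\<in>?E. \<exists>k\<ge>N. z = \<zeta> e k) \<and> deriv ?F z \<noteq> 0"
    by (rule zero_sequences[OF S, of D], erule D, rule that)
  define \<rho> where "\<rho> = max \<rho>0 0"
  have b: "b = (\<Sum>e\<in>?E. dist (fst e) (snd e))" by (simp add: b_def case_prod_beta)
  define A where "A E = {z \<in> {z. ?F z = 0}. \<rho> \<le> norm z \<and> norm z \<le> E}" for E
  obtain B where finA: "\<And>E. E \<ge> 0 \<Longrightarrow> finite (A E)"
    and B: "\<And>E. E \<ge> 0 \<Longrightarrow> \<bar>real (card (A E)) - b * E / (2 * pi)\<bar> \<le> B"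
    unfolding b A_def
  proof (rule card_sequences_upto[where P = ?E and L = "\<lambda>e. dist (fst e) (snd e)" and N = N
        and \<zeta> = \<zeta> and C = C and Z = "{z. ?F z = 0}" and \<rho> = \<rho>])
    show "finite ?E" using oriented_edges_finite[OF S(1)] .
    show "dist (fst e) (snd e) > 0" if "e \<in> ?E" for e
      using that by (auto simp: oriented_edges_def)
    show "\<exists>e\<in>?E. \<exists>k\<ge>N. z = \<zeta> e k" if "z \<in> {z. ?F z = 0}" "norm z \<ge> \<rho>" for z
      using \<zeta>(4)[of z] that by (auto simp: \<rho>_def)
  qed (use \<zeta> in auto)
  have hol: "?F holomorphic_on UNIV" by (rule frequency_sum_holomorphic)
  define A0 where "A0 = {z. ?F z = 0 \<and> norm z < \<rho>}"
  have finA0: "finite A0"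
  proof (cases "?F constant_on UNIV")
    case True
    have "?F z \<noteq> 0" for z
    proof
      assume "?F z = 0"
      then have "?F x = 0" for x using True by (auto simp: constant_on_def)
      \<comment> \<open>A sum that vanished identically would have infinitely many zeros in an annulus.\<close>
      then have "complex_of_real ` {\<rho>..\<rho> + 1} \<subseteq> A (\<rho> + 1)" by (auto simp: A_def \<rho>_def)
      then have "finite (complex_of_real ` {\<rho>..\<rho> + 1})"
        using finA[of "\<rho> + 1"] finite_subset by (auto simp: \<rho>_def)
      then have "finite {\<rho>..\<rho> + 1}" by (rule finite_imageD) (auto simp: inj_on_def)
      then show False by (simp add: infinite_Icc)
    qed
    then show ?thesis by (simp add: A0_def)
  next
    case False
    have "finite {z \<in> cball 0 \<rho>. ?F z = 0}"
      by (rule holomorphic_compact_finite_zeros[OF hol _ _ _ _ False]) auto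
    then show ?thesis by (rule rev_finite_subset) (auto simp: A0_def)
  qed
  have split: "zeros_upto ?F E = A0 \<union> A E" "A0 \<inter> A E = {}" if "E \<ge> \<rho>" for E
    using that by (auto simp: zeros_upto_def A0_def A_def)
  have simple: "zorder ?F z = 1" if "z \<in> A E" for z E
    by (rule zorder_simple_zero[OF hol]) (use that \<zeta>(4)[of z] in \<open>auto simp: A_def \<rho>_def\<close>)
  have count: "zero_count ?F E = card A0 + real (card (A E))" if "E \<ge> \<rho>" for E
    using split[OF that] finA0 finA[of E] that by (simp add: zero_count_def card_Un_disjoint \<rho>_def)
  have count_mult: "zero_count_mult ?F E = (\<Sum>z\<in>A0. real_of_int (zorder ?F z)) + real (card (A E))"
    if "E \<ge> \<rho>" for E
    using split[OF that] finA0 finA[of E] that simple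
    by (simp add: zero_count_mult_def sum.union_disjoint \<rho>_def)
  show "(\<lambda>E. zero_count ?F E - b * E / (2 * pi)) \<in> O[at_top](\<lambda>_. 1)"
  proof (rule bigoI[where c = "card A0 + B"], rule eventually_mono[OF eventually_ge_at_top[of \<rho>]])
    fix E assume "\<rho> \<le> E"
    then show "norm (zero_count ?F E - b * E / (2 * pi)) \<le> (card A0 + B) * norm (1 :: real)"
      using B[of E] count[of E] by (simp add: \<rho>_def)
  qed
  show "(\<lambda>E. zero_count_mult ?F E - b * E / (2 * pi)) \<in> O[at_top](\<lambda>_. 1)"
  proof (rule bigoI[where c = "\<bar>\<Sum>z\<in>A0. real_of_int (zorder ?F z)\<bar> + B"],
      rule eventually_mono[OF eventually_ge_at_top[of \<rho>]])
    fix E assume "\<rho> \<le> E"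
    then show "norm (zero_count_mult ?F E - b * E / (2 * pi))
        \<le> (\<bar>\<Sum>z\<in>A0. real_of_int (zorder ?F z)\<bar> + B) * norm (1 :: real)"
      using B[of E] count_mult[of E] by (simp add: \<rho>_def)
  qed
qed

text \<open>As the \<open>\<gamma> r\<close> are distinct, the coefficients can be indexed by the frequencies themselves, so that
\<open>exp_sum\<close> is a \<open>frequency_sum\<close>.\<close>
theorem corollary7:
  fixes R :: nat and \<gamma> \<delta> :: "nat \<Rightarrow> complex"
  assumes "R \<ge> 2"
    and "inj_on \<gamma> {1..R}"
    and "\<And>r. r \<in> {1..R} \<Longrightarrow> \<delta> r \<noteq> 0"
    and "generic_exponents R \<gamma>"
  shows "(\<lambda>E::real. zero_count_mult (exp_sum R \<delta> \<gamma>) E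
             - boundary_length (exponent_hull R \<gamma>) * E / (2 * pi)) \<in> O[at_top](\<lambda>_. 1) \<and>
         (\<lambda>E::real. zero_count (exp_sum R \<delta> \<gamma>) E
             - boundary_length (exponent_hull R \<gamma>) * E / (2 * pi)) \<in> O[at_top](\<lambda>_. 1)"
proof -
  define S where "S = \<gamma> ` {1..R}"
  define D where "D p = \<delta> (inv_into {1..R} \<gamma> p)" for p
  have D\<gamma>: "D (\<gamma> r) = \<delta> r" if "r \<in> {1..R}" for r
    using inv_into_f_f[OF assms(2) that] by (simp add: D_def)
  have S: "finite S" "\<gamma> 1 \<in> S" "\<gamma> 2 \<in> S" "\<gamma> 1 \<noteq> \<gamma> 2"
    using assms(1) inj_onD[OF assms(2), of 1 2] by (auto simp: S_def)
  have F: "exp_sum R \<delta> \<gamma> = frequency_sum S D"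
    unfolding exp_sum_def[abs_def] frequency_sum_def[abs_def] S_def sum.reindex[OF assms(2)] o_def
    by (intro ext sum.cong refl) (simp only: D\<gamma>)
  have hull: "exponent_hull R \<gamma> = convex hull S" by (simp add: exponent_hull_def S_def)
  have edges: "edges_without_inner_points S"
    using assms(4) unfolding generic_exponents_def hull
    by (intro generic_imp_edges_without_inner_points) (auto simp: S_def)
  have D0: "D p \<noteq> 0" if "p \<in> S" for p using that assms(3) D\<gamma> by (auto simp: S_def)
  have "S \<noteq> {}" using S by blast
  from frequency_sum_zero_counts[OF S(1) edges this, of D] D0
  show ?thesis
    unfolding F hull boundary_length_eq_sum_oriented_edges[OF S(1) edges S(2-4)] by blast
qed

end
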